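(* Let $(\mathbb{M},\mathbf{d})$ be a metric space, let $X\subset\mathbb{M}$ be a subset with $n+1$ points, let $\sigma_g:\{0,\ldots,n\}\to X$ be a greedy permutation, and let $0<\epsilon<1$. Let $0\le\alpha\le\beta$. Then the diagrams $$\begin{array}{ccc}H^1(\check{\mathcal{C}}_\alpha(\sigma_g,\epsilon);\mathbb{Z}/2)&\xrightarrow{\ \mathbf{w}_1^\alpha\ }&\left[\bigcup\mathcal{B}^\alpha,\mathbb{R}\mathbf{P}^\infty\right]\\ \uparrow&&\uparrow\\ H^1(\check{\mathcal{C}}_\beta(\sigma_g,\epsilon);\mathbb{Z}/2)&\xrightarrow{\ \mathbf{w}_1^\beta\ }&\left[\bigcup\mathcal{B}^\beta,\mathbb{R}\mathbf{P}^\infty\right]\end{array}\qquad\begin{array}{ccc}H^2(\check{\mathcal{C}}_\alpha(\sigma_g,\epsilon);\mathbb{Z})&\xrightarrow{\ \mathbf{c}_1^\alpha\ }&\left[\bigcup\mathcal{B}^\alpha,\mathbb{C}\mathbf{P}^\infty\right]\\ \uparrow&&\uparrow\\ H^2(\check{\mathcal{C}}_\beta(\sigma_g,\epsilon);\mathbb{Z})&\xrightarrow{\ \mathbf{c}_1^\beta\ }&\left[\bigcup\mathcal{B}^\beta,\mathbb{C}\mathbf{P}^\infty\right]\end{array}$$ are commutative, where the left vertical maps are induced by the inclusion of simplicial complexes $\check{\mathcal{C}}_\alpha(\sigma_g,\epsilon)\subset\check{\mathcal{C}}_\beta(\sigma_g,\epsilon)$ and the right vertical maps are given by restriction along the inclusion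 $\bigcup\mathcal{B}^\alpha\subset\bigcup\mathcal{B}^\beta$.
   Context: A greedy permutation on $X$ is a bijection $\sigma_g:\{0,\ldots,n\}\to X$ such that, for $s=0,\ldots,n-1$, $\sigma_g(s+1)$ maximizes $x\mapsto\mathbf{d}(x,\{\sigma_g(0),\ldots,\sigma_g(s)\})$ over $x\in X$. Write $x_s=\sigma_g(s)$. The insertion radii are $\lambda_0=\infty$ and $\lambda_s=\mathbf{d}(x_s,\{x_0,\ldots,x_{s-1}\})$ for $s>0$. For $\alpha\ge0$, $$r_s(\alpha)=\begin{cases}\alpha&\text{if }\alpha<\lambda_s(1+\epsilon)/\epsilon,\\ \lambda_s(1+\epsilon)/\epsilon&\text{if }\lambda_s(1+\epsilon)/\epsilon\le\alpha\le\lambda_s(1+\epsilon)^2/\epsilon,\\ 0&\text{if }\alpha>\lambda_s(1+\epsilon)^2/\epsilon.\end{cases}$$ $B_s^\alpha=\{b\in\mathbb{M}:\mathbf{d}(b,x_s)<r_s(\alpha)\}$; $S_\alpha=\{s:\lambda_s\ge\epsilon\alpha/(1+\epsilon)^2\}$; $\mathcal{B}^\alpha=\{B_s^\alpha:s\in S_\alpha\}$; $U_s^\alpha=\bigcup_{0\le\lambda\le\alpha}(B_s^\lambda\times\{\lambda\})\subset\mathbb{M}\times\mathbb{R}$; $\mathcal{U}^\alpha=\{U_s^\alpha:s=0,\ldots,n\}$. The sparse Čech complex $\check{\mathcal{C}}_\alpha(\sigma_g,\epsilon)$ is the nerve of $\mathcal{U}^\alpha$: its simplices are the nonempty $\{s_0,\ldots,s_k\}\subset\{0,\ldots,n\}$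 with $U_{s_0}^\alpha\cap\cdots\cap U_{s_k}^\alpha\ne\emptyset$. Cochains $C^k(K;G)$ on a simplicial complex $K$ with vertices in $\{0,\dots,n\}$ are $G$-valued functions on $k$-simplices, with $\delta^k(\phi)(\{s_0<\cdots<s_{k+1}\})=\sum_j(-1)^j\phi(\{s_0,\ldots,s_{k+1}\}\smallsetminus\{s_j\})$. Write $\tau_{rt}=\tau(\{r,t\})$, $\tau_{rr}=0$ for $\mathbb{Z}/2$-cochains; for real cochains $\nu$ (degree 1), $\theta$ (degree 2), $\nu_{rs}$ and $\theta_{rst}$ are the alternating extensions of their values on increasingly ordered simplices. With $|x|_+=\max\{x,0\}$, put $$\varphi_s^\alpha(b)=\frac{|r_s(\alpha)-\mathbf{d}(b,x_s)|_+^2}{\sum_{t=0}^n|r_t(\alpha)-\mathbf{d}(b,x_t)|_+^2},\quad b\in\textstyle\bigcup\mathcal{B}^\alpha .$$ $\mathbf{w}_1^\alpha([\tau])$ is the homotopy class of the map $\bigcup\mathcal{B}^\alpha\to\mathbb{R}\mathbf{P}^n\subset\mathbb{R}\mathbf{P}^\infty$ given for $b\in B_j^\alpha$ by $b\mapsto\left[(-1)^{\tau_{0j}}\sqrt{\varphi_0^\alpha(b)}:\cdots:(-1)^{\tau_{nj}}\sqrt{\varphi_n^\alpha(b)}\right]$. $\mathbf{c}_1^\alpha([\eta])$ is the homotopy class of the map $\bigcup\mathcal{B}^\alpha\to\mathbb{C}\mathbf{P}^n\subset\mathbb{C}\mathbf{P}^\infty$ whose $r$-th homogeneous coordinate at $b\in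 B_j^\alpha$ is $e^{2\pi i(\nu_{rj}+\sum_t\varphi_t^\alpha(b)\theta_{rjt})}\sqrt{\varphi_r^\alpha(b)}$, where $\theta$ is the harmonic real cocycle on $\check{\mathcal{C}}_\alpha(\sigma_g,\epsilon)$ representing the image of $[\eta]$ in real cohomology (i.e. the unique representative orthogonal to all coboundaries for the inner product $\langle\beta_1,\beta_2\rangle=\sum_\sigma\beta_1(\sigma)\beta_2(\sigma)$) and $\nu$ is a real $1$-cochain with $\theta=\eta-\delta^1(\nu)$. Terms with $\varphi^\alpha_r(b)=0$ or $\varphi^\alpha_t(b)=0$ are read as $0$. These classes are well-defined. $[B,Y]$ is the set of homotopy classes of continuous maps $B\to Y$. *)

theory Defs
  imports "HOL-Analysis.Analysis" "HOL-Library.Z2"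
begin

section \<open>Infinite projective spaces\<close>

definition quotient_topology :: "('a \<Rightarrow> 'b) \<Rightarrow> 'a topology \<Rightarrow> 'b topology" where
  "quotient_topology q T =
     topology (\<lambda>U. U \<subseteq> q ` topspace T \<and> openin T {x \<in> topspace T. q x \<in> U})"

lemma istopology_quotient:
  "istopology (\<lambda>U. U \<subseteq> q ` topspace T \<and> openin T {x \<in> topspace T. q x \<in> U})"
proof -
  have "openin T {x \<in> topspace T. q x \<in> S \<inter> U}"
    if "openin T {x \<in> topspace T. q x \<in> S}" "openin T {x \<in> topspace T. q x \<in> U}" for S U
    using openin_Int[OF that] by (rule back_subst[of "openin T"]) blast
  moreover have "openin T {x \<in> topspace T. q x \<in> \<Union>\<U>}"
    if "\<And>U. U \<in> \<U> \<Longrightarrow> openin T {x \<in> topspace T. q x \<in> U}" for \<U>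
  proof -
    have "openin T (\<Union>U\<in>\<U>. {x \<in> topspace T. q x \<in> U})"
      using that by (intro openin_Union) auto
    then show ?thesis by (rule back_subst[of "openin T"]) blast
  qed
  ultimately show ?thesis
    unfolding istopology_def by (simp add: Sup_le_iff) blast
qed

lemma openin_quotient_topology:
  "openin (quotient_topology q T) U \<longleftrightarrow>
     U \<subseteq> q ` topspace T \<and> openin T {x \<in> topspace T. q x \<in> U}"
  by (simp add: quotient_topology_def topology_inverse'[OF istopology_quotient])

lemma topspace_quotient_topology [simp]:
  "topspace (quotient_topology q T) = q ` topspace T"
proof -
  have "{x \<in> topspace T. q x \<in> q ` topspace T} = topspace T" by auto
  then have "openin (quotient_topology q T) (q ` topspace T)"
    by (simp add: openin_quotient_topology)
  then show ?thesis
    by (metis openin_quotient_topology openin_subset openin_topspace subset_antisym)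
qed

text \<open>The topology of the union of an increasing sequence of spaces (direct limit topology).\<close>

definition colimit_topology :: "(nat \<Rightarrow> 'a topology) \<Rightarrow> 'a topology" where
  "colimit_topology T =
     topology (\<lambda>U. U \<subseteq> (\<Union>n. topspace (T n)) \<and> (\<forall>n. openin (T n) (U \<inter> topspace (T n))))"

lemma istopology_colimit:
  "istopology (\<lambda>U. U \<subseteq> (\<Union>n. topspace (T n)) \<and> (\<forall>n. openin (T n) (U \<inter> topspace (T n))))"
proof -
  have "openin (T n) (S \<inter> U \<inter> topspace (T n))"
    if "openin (T n) (S \<inter> topspace (T n))" "openin (T n) (U \<inter> topspace (T n))" for S U n
    using openin_Int[OF that] by (rule back_subst[of "openin (T n)"]) blast
  moreover have "openin (T n) (\<Union>\<U> \<inter> topspace (T n))"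
    if "\<And>U. U \<in> \<U> \<Longrightarrow> openin (T n) (U \<inter> topspace (T n))" for \<U> n
  proof -
    have "openin (T n) (\<Union>U\<in>\<U>. U \<inter> topspace (T n))"
      using that by (intro openin_Union) auto
    then show ?thesis by (rule back_subst[of "openin (T n)"]) blast
  qed
  ultimately show ?thesis
    unfolding istopology_def by (simp add: Sup_le_iff) blast
qed

lemma openin_colimit_topology:
  "openin (colimit_topology T) U \<longleftrightarrow>
     U \<subseteq> (\<Union>n. topspace (T n)) \<and> (\<forall>n. openin (T n) (U \<inter> topspace (T n)))"
  by (simp add: colimit_topology_def topology_inverse'[OF istopology_colimit])

text \<open>Points of projective space are the punctured lines \<open>[z\<^sub>0 : z\<^sub>1 : \<dots>]\<close> in the space of sequences.
  With this representation the \<open>n\<close>-dimensional projective spaces are nested.\<close>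

definition homog :: "(nat \<Rightarrow> 'k::real_normed_field) \<Rightarrow> (nat \<Rightarrow> 'k) set" where
  "homog z = {w. \<exists>c. c \<noteq> 0 \<and> w = (\<lambda>i. c * z i)}"

definition punctured_space :: "nat \<Rightarrow> (nat \<Rightarrow> 'k::real_normed_field) topology" where
  "punctured_space n =
     subtopology (product_topology (\<lambda>_. euclidean) UNIV) {z. (\<forall>i>n. z i = 0) \<and> (\<exists>i. z i \<noteq> 0)}"

definition proj_space :: "nat \<Rightarrow> (nat \<Rightarrow> 'k::real_normed_field) set topology" where
  "proj_space n = quotient_topology homog (punctured_space n)"

definition inf_proj_space :: "(nat \<Rightarrow> 'k::real_normed_field) set topology" where
  "inf_proj_space = colimit_topology proj_space"

abbreviation RP_inf :: "(nat \<Rightarrow> real) set topology" where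
  "RP_inf \<equiv> inf_proj_space"

abbreviation CP_inf :: "(nat \<Rightarrow> complex) set topology" where
  "CP_inf \<equiv> inf_proj_space"


section \<open>Homotopy classes of maps\<close>

text \<open>A map from \<open>X\<close> is a total function of which only the values on \<open>topspace X\<close> matter:
  functions that agree on \<open>topspace X\<close> and are continuous there are homotopic.\<close>

definition homotopy_rel :: "'a topology \<Rightarrow> 'b topology \<Rightarrow> (('a \<Rightarrow> 'b) \<times> ('a \<Rightarrow> 'b)) set" where
  "homotopy_rel X Y = {(f, g). homotopic_with (\<lambda>_. True) X Y f g}"

definition homotopy_classes :: "'a topology \<Rightarrow> 'b topology \<Rightarrow> ('a \<Rightarrow> 'b) set set" where
  "homotopy_classes X Y = {f. continuous_map X Y f} // homotopy_rel X Y"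

text \<open>The map \<open>[X, Y] \<rightarrow> [A, Y]\<close> given by restriction to a subspace \<open>A\<close> of \<open>X\<close>.
  Here and below, a map defined on representatives of a class is lifted to classes as the
  union of the resulting classes over all representatives, as in theory \<open>Equiv_Relations\<close>.\<close>

definition restrict_homotopy_class ::
    "'a topology \<Rightarrow> 'b topology \<Rightarrow> ('a \<Rightarrow> 'b) set \<Rightarrow> ('a \<Rightarrow> 'b) set" where
  "restrict_homotopy_class A Y c = (\<Union>f\<in>c. homotopy_rel A Y `` {f})"


section \<open>Simplicial cohomology\<close>

text \<open>A complex is given by its set of simplices, which are nonempty finite sets of naturals.
  Cochains are extended by zero to all sets that are not \<open>k\<close>-simplices.\<close>

definition cochains :: "nat set set \<Rightarrow> nat \<Rightarrow> (nat set \<Rightarrow> 'g::comm_ring_1) set" where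
  "cochains K k = {\<phi>. \<forall>A. \<not> (A \<in> K \<and> card A = Suc k) \<longrightarrow> \<phi> A = 0}"

definition coboundary ::
    "nat set set \<Rightarrow> nat \<Rightarrow> (nat set \<Rightarrow> 'g::comm_ring_1) \<Rightarrow> nat set \<Rightarrow> 'g" where
  "coboundary K k \<phi> A =
     (if A \<in> K \<and> card A = k + 2
      then \<Sum>j\<le>k + 1. (- 1) ^ j * \<phi> (A - {sorted_list_of_set A ! j}) else 0)"

definition cocycles :: "nat set set \<Rightarrow> nat \<Rightarrow> (nat set \<Rightarrow> 'g::comm_ring_1) set" where
  "cocycles K k = {\<phi> \<in> cochains K k. coboundary K k \<phi> = (\<lambda>_. 0)}"

definition coboundaries :: "nat set set \<Rightarrow> nat \<Rightarrow> (nat set \<Rightarrow> 'g::comm_ring_1) set" where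
  "coboundaries K k = (case k of 0 \<Rightarrow> {\<lambda>_. 0} | Suc l \<Rightarrow> coboundary K l ` cochains K l)"

definition cohomologous ::
    "nat set set \<Rightarrow> nat \<Rightarrow> ((nat set \<Rightarrow> 'g::comm_ring_1) \<times> (nat set \<Rightarrow> 'g)) set" where
  "cohomologous K k =
     {(\<phi>, \<psi>). \<phi> \<in> cocycles K k \<and> \<psi> \<in> cocycles K k \<and> (\<lambda>A. \<phi> A - \<psi> A) \<in> coboundaries K k}"

definition cohomology :: "nat set set \<Rightarrow> nat \<Rightarrow> (nat set \<Rightarrow> 'g::comm_ring_1) set set" where
  "cohomology K k = cocycles K k // cohomologous K k"

text \<open>The map \<open>H\<^sup>k(K) \<rightarrow> H\<^sup>k(L)\<close> induced by the inclusion of a subcomplex \<open>L\<close> of \<open>K\<close>.\<close>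

definition restrict_cohomology ::
    "nat set set \<Rightarrow> nat \<Rightarrow> (nat set \<Rightarrow> 'g::comm_ring_1) set \<Rightarrow> (nat set \<Rightarrow> 'g) set" where
  "restrict_cohomology L k c =
     (\<Union>\<phi>\<in>c. cohomologous L k `` {\<lambda>A. if A \<in> L then \<phi> A else 0})"

definition harmonic :: "nat set set \<Rightarrow> nat \<Rightarrow> (nat set \<Rightarrow> real) \<Rightarrow> bool" where
  "harmonic K k \<theta> \<longleftrightarrow>
     \<theta> \<in> cocycles K k \<and>
     (\<forall>\<beta>\<in>coboundaries K k. (\<Sum>A | A \<in> K \<and> card A = Suc k. \<theta> A * \<beta> A) = 0)"

text \<open>The alternating extension of a cochain to sequences of vertices; the exponent is the number
  of inversions.\<close>

definition alternating :: "(nat set \<Rightarrow> real) \<Rightarrow> nat list \<Rightarrow> real" where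
  "alternating \<phi> vs =
     (if distinct vs
      then (- 1) ^ card {(i, j). i < j \<and> j < length vs \<and> vs ! j < vs ! i} * \<phi> (set vs)
      else 0)"


section \<open>Greedy permutations and the sparse Cech complex\<close>

definition greedy_permutation :: "nat \<Rightarrow> 'a::metric_space set \<Rightarrow> (nat \<Rightarrow> 'a) \<Rightarrow> bool" where
  "greedy_permutation n X \<sigma> \<longleftrightarrow>
     bij_betw \<sigma> {0..n} X \<and>
     (\<forall>s<n. \<forall>x\<in>X. infdist x (\<sigma> ` {0..s}) \<le> infdist (\<sigma> (Suc s)) (\<sigma> ` {0..s}))"

definition insertion_radius :: "(nat \<Rightarrow> 'a::metric_space) \<Rightarrow> nat \<Rightarrow> ereal" where
  "insertion_radius \<sigma> s = (if s = 0 then \<infinity> else ereal (infdist (\<sigma> s) (\<sigma> ` {0..<s})))"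

text \<open>For \<open>s = 0\<close> the first case applies to every \<open>\<alpha>\<close>, so \<open>real_of_ereal\<close> is only relevant
  for finite values.\<close>

definition radius :: "(nat \<Rightarrow> 'a::metric_space) \<Rightarrow> real \<Rightarrow> nat \<Rightarrow> real \<Rightarrow> real" where
  "radius \<sigma> \<epsilon> s \<alpha> =
     (if ereal \<alpha> < insertion_radius \<sigma> s * ereal ((1 + \<epsilon>) / \<epsilon>) then \<alpha>
      else if ereal \<alpha> \<le> insertion_radius \<sigma> s * ereal ((1 + \<epsilon>)\<^sup>2 / \<epsilon>)
      then real_of_ereal (insertion_radius \<sigma> s * ereal ((1 + \<epsilon>) / \<epsilon>))
      else 0)"

definition sparse_ball :: "(nat \<Rightarrow> 'a::metric_space) \<Rightarrow> real \<Rightarrow> nat \<Rightarrow> real \<Rightarrow> 'a set" where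
  "sparse_ball \<sigma> \<epsilon> s \<alpha> = {b. dist b (\<sigma> s) < radius \<sigma> \<epsilon> s \<alpha>}"

definition active :: "(nat \<Rightarrow> 'a::metric_space) \<Rightarrow> nat \<Rightarrow> real \<Rightarrow> real \<Rightarrow> nat set" where
  "active \<sigma> n \<epsilon> \<alpha> = {s \<in> {0..n}. insertion_radius \<sigma> s \<ge> ereal (\<epsilon> * \<alpha> / (1 + \<epsilon>)\<^sup>2)}"

definition sparse_cover :: "(nat \<Rightarrow> 'a::metric_space) \<Rightarrow> nat \<Rightarrow> real \<Rightarrow> real \<Rightarrow> 'a set set" where
  "sparse_cover \<sigma> n \<epsilon> \<alpha> = (\<lambda>s. sparse_ball \<sigma> \<epsilon> s \<alpha>) ` active \<sigma> n \<epsilon> \<alpha>"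

definition ball_history ::
    "(nat \<Rightarrow> 'a::metric_space) \<Rightarrow> real \<Rightarrow> nat \<Rightarrow> real \<Rightarrow> ('a \<times> real) set" where
  "ball_history \<sigma> \<epsilon> s \<alpha> = (\<Union>l\<in>{0..\<alpha>}. sparse_ball \<sigma> \<epsilon> s l \<times> {l})"

definition sparse_cech :: "(nat \<Rightarrow> 'a::metric_space) \<Rightarrow> nat \<Rightarrow> real \<Rightarrow> real \<Rightarrow> nat set set" where
  "sparse_cech \<sigma> n \<epsilon> \<alpha> =
     {A. A \<noteq> {} \<and> A \<subseteq> {0..n} \<and> (\<Inter>s\<in>A. ball_history \<sigma> \<epsilon> s \<alpha>) \<noteq> {}}"

definition partition_fun ::
    "(nat \<Rightarrow> 'a::metric_space) \<Rightarrow> nat \<Rightarrow> real \<Rightarrow> real \<Rightarrow> nat \<Rightarrow> 'a \<Rightarrow> real" where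
  "partition_fun \<sigma> n \<epsilon> \<alpha> s b =
     (max (radius \<sigma> \<epsilon> s \<alpha> - dist b (\<sigma> s)) 0)\<^sup>2 /
     (\<Sum>t = 0..n. (max (radius \<sigma> \<epsilon> t \<alpha> - dist b (\<sigma> t)) 0)\<^sup>2)"


abbreviation cover_space :: "(nat \<Rightarrow> 'a::metric_space) \<Rightarrow> nat \<Rightarrow> real \<Rightarrow> real \<Rightarrow> 'a topology" where
  "cover_space \<sigma> n \<epsilon> \<alpha> \<equiv> top_of_set (\<Union>(sparse_cover \<sigma> n \<epsilon> \<alpha>))"


section \<open>The characteristic class maps\<close>

text \<open>In both maps below, the value at \<open>b\<close> is the point that has the given homogeneous
  coordinates for every \<open>j\<close> whose ball contains \<open>b\<close>. Coordinates with vanishing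
  \<open>partition_fun\<close>, and likewise the summands in the exponent, are zero because of the
  factors \<open>sqrt 0\<close> and \<open>0\<close>, also when the cochain is evaluated outside the complex.\<close>

definition w1_map ::
    "(nat \<Rightarrow> 'a::metric_space) \<Rightarrow> nat \<Rightarrow> real \<Rightarrow> real \<Rightarrow> (nat set \<Rightarrow> bit) \<Rightarrow> 'a \<Rightarrow> (nat \<Rightarrow> real) set"
  where
  "w1_map \<sigma> n \<epsilon> \<alpha> \<tau> b =
     (THE p. \<forall>j\<in>active \<sigma> n \<epsilon> \<alpha>. b \<in> sparse_ball \<sigma> \<epsilon> j \<alpha> \<longrightarrow>
        p = homog (\<lambda>r. if r \<le> n
              then (if r = j \<or> \<tau> {r, j} = 0 then 1 else - 1) * sqrt (partition_fun \<sigma> n \<epsilon> \<alpha> r b)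
              else 0))"

definition w1_class ::
    "(nat \<Rightarrow> 'a::metric_space) \<Rightarrow> nat \<Rightarrow> real \<Rightarrow> real \<Rightarrow> (nat set \<Rightarrow> bit) set
      \<Rightarrow> ('a \<Rightarrow> (nat \<Rightarrow> real) set) set" where
  "w1_class \<sigma> n \<epsilon> \<alpha> c =
     (\<Union>\<tau>\<in>c. homotopy_rel (cover_space \<sigma> n \<epsilon> \<alpha>) RP_inf `` {w1_map \<sigma> n \<epsilon> \<alpha> \<tau>})"

definition c1_map ::
    "(nat \<Rightarrow> 'a::metric_space) \<Rightarrow> nat \<Rightarrow> real \<Rightarrow> real \<Rightarrow> (nat set \<Rightarrow> real) \<Rightarrow> (nat set \<Rightarrow> real)
      \<Rightarrow> 'a \<Rightarrow> (nat \<Rightarrow> complex) set" where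
  "c1_map \<sigma> n \<epsilon> \<alpha> \<theta> \<nu> b =
     (THE p. \<forall>j\<in>active \<sigma> n \<epsilon> \<alpha>. b \<in> sparse_ball \<sigma> \<epsilon> j \<alpha> \<longrightarrow>
        p = homog (\<lambda>r. if r \<le> n
              then cis (2 * pi * (alternating \<nu> [r, j] +
                       (\<Sum>t = 0..n. partition_fun \<sigma> n \<epsilon> \<alpha> t b * alternating \<theta> [r, j, t])))
                     * complex_of_real (sqrt (partition_fun \<sigma> n \<epsilon> \<alpha> r b))
              else 0))"

text \<open>The auxiliary choices are a cocycle \<open>\<eta>\<close> in the class, its harmonic representative \<open>\<theta>\<close>
  and a cochain \<open>\<nu>\<close> with \<open>\<theta> = \<eta> - \<delta>\<nu>\<close>.\<close>

definition c1_class ::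
    "(nat \<Rightarrow> 'a::metric_space) \<Rightarrow> nat \<Rightarrow> real \<Rightarrow> real \<Rightarrow> (nat set \<Rightarrow> int) set
      \<Rightarrow> ('a \<Rightarrow> (nat \<Rightarrow> complex) set) set" where
  "c1_class \<sigma> n \<epsilon> \<alpha> c =
     (let K = sparse_cech \<sigma> n \<epsilon> \<alpha> in
      \<Union>{homotopy_rel (cover_space \<sigma> n \<epsilon> \<alpha>) CP_inf `` {c1_map \<sigma> n \<epsilon> \<alpha> \<theta> \<nu>}
         | \<eta> \<theta> \<nu>. \<eta> \<in> c \<and> harmonic K 2 \<theta> \<and> \<nu> \<in> cochains K 1
             \<and> \<theta> = (\<lambda>A. real_of_int (\<eta> A) - coboundary K 1 \<nu> A)})"


section \<open>Commutative squares\<close>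

definition commutative_square ::
    "'a set \<Rightarrow> 'b set \<Rightarrow> 'c set \<Rightarrow> 'd set \<Rightarrow> ('a \<Rightarrow> 'b) \<Rightarrow> ('c \<Rightarrow> 'd) \<Rightarrow> ('c \<Rightarrow> 'a) \<Rightarrow> ('d \<Rightarrow> 'b) \<Rightarrow> bool"
  where
  "commutative_square A B A' B' top_arrow bot_arrow left_arrow right_arrow \<longleftrightarrow>
     top_arrow \<in> A \<rightarrow> B \<and> bot_arrow \<in> A' \<rightarrow> B' \<and> left_arrow \<in> A' \<rightarrow> A \<and> right_arrow \<in> B' \<rightarrow> B \<and>
     (\<forall>x\<in>A'. top_arrow (left_arrow x) = right_arrow (bot_arrow x))"

end

(*
A map to an infinite projective space is determined up to homotopy by transition functions: if local
lifts z_j and z'_j transform by the same scalars, then [(1 - u) z_j : u z'_j] is a well-defined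
homotopy between the two maps after moving one of them into fresh coordinates. The lifts defining w_1
have the constant transition functions (-1)^tau_rj. For c_1, since theta = eta - delta nu and the
weights sum to 1, the transition functions are a_r g_rj / a_j with
g_rj = exp(2 pi i sum_t phi_t eta_rjt) and a_r = exp(2 pi i sum_t phi_t nu_rt), so the homotopy class
depends only on eta, and cohomologous eta give conjugate g.

Hence commutativity only requires a path from the partition of unity at scale alpha to the one at scale
beta, on the union of the balls at scale alpha, whose supports are simplices of the complex at scale
beta. The supports at (b, l) for alpha <= l <= beta are such simplices because (b, l) lies in all the
sets U_s involved. The radii r_s(l) drop to 0 discontinuously, but multiplying the weight of s by a
factor that vanishes at the drop makes the path continuous, and the weights still have a positive sum:
a ball that has been dropped at scale l is contained in a ball of radius l around a point of insertion
radius at least epsilon l / (1 + epsilon).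
*)
theory Submission
  imports Defs
begin

section \<open>Maps to projective spaces from transition functions\<close>

text \<open>Within one set of coordinates the interpolation (1 - u) z + u z' can vanish, because the
  two lifts may cancel. This is why the coordinates are doubled from 0..n to 0..2n+1, which the
  infinite projective space absorbs. A straight line between the partitions of unity at scales
  \<alpha> and \<beta> is not admissible: the balls containing b at scale \<alpha> and those at
  scale \<beta> need not have histories with a common point, so the union of both supports need not
  be a simplex. The path therefore runs through the intermediate scales, and straight lines join
  only partitions at one and the same scale. For c_1 the transition functions depend on the weights,
  so a path of weights carries its transition functions along; their cocycle identity is pointwise
  and only asks that the support be a simplex. \<open>c1_class\<close> is a union over all
  admissible choices and would be empty if there were none, hence the construction of harmonic
  representatives.\<close>

lemma homog_scale:
  assumes "c \<noteq> 0"
  shows "homog (\<lambda>i. c * z i) = homog z"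
proof -
  have "\<exists>d. d \<noteq> 0 \<and> (\<lambda>i. k * (c * z i)) = (\<lambda>i. d * z i)" if "k \<noteq> 0" for k
    using that assms by (intro exI[of _ "k * c"]) (simp add: mult.assoc)
  moreover have "\<exists>d. d \<noteq> 0 \<and> (\<lambda>i. k * z i) = (\<lambda>i. d * (c * z i))" if "k \<noteq> 0" for k
    using that assms by (intro exI[of _ "k / c"]) simp
  ultimately show ?thesis
    unfolding homog_def by blast
qed

text \<open>The maps below have coordinates bounded by a fixed index, so continuity into the colimit
  is only ever checked through one finite stage.\<close>

lemma continuous_map_homog:
  "continuous_map (punctured_space N) inf_proj_space homog"
  unfolding continuous_map_def
proof (intro conjI allI impI)
  show "homog \<in> topspace (punctured_space N) \<rightarrow> topspace inf_proj_space"
  proof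
    fix z assume z: "z \<in> topspace (punctured_space N)"
    have "openin inf_proj_space (\<Union>n. topspace (proj_space n))"
      unfolding inf_proj_space_def openin_colimit_topology
    proof (intro conjI allI subset_refl)
      fix m
      have "openin (proj_space m) (topspace (proj_space m))" by simp
      then show "openin (proj_space m) ((\<Union>n. topspace (proj_space n)) \<inter> topspace (proj_space m))"
        by (rule back_subst[of "openin (proj_space m)"]) blast
    qed
    moreover have "homog z \<in> topspace (proj_space N)"
      using z by (simp add: proj_space_def)
    ultimately show "homog z \<in> topspace inf_proj_space"
      using openin_subset by blast
  qed
next
  fix U assume "openin inf_proj_space U"
  then have U: "openin (proj_space N) (U \<inter> topspace (proj_space N))"
    by (simp add: inf_proj_space_def openin_colimit_topology)
  then have "openin (punctured_space N)
      {x \<in> topspace (punctured_space N). homog x \<in> U \<inter> topspace (proj_space N)}"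
    unfolding proj_space_def openin_quotient_topology by auto
  then show "openin (punctured_space N) {x \<in> topspace (punctured_space N). homog x \<in> U}"
    by (rule back_subst[of "openin (punctured_space N)"]) (auto simp: proj_space_def)
qed

definition line_lift ::
    "nat \<Rightarrow> (nat \<Rightarrow> 'b \<Rightarrow> real) \<Rightarrow> (nat \<Rightarrow> nat \<Rightarrow> 'b \<Rightarrow> 'k) \<Rightarrow> nat \<Rightarrow> 'b \<Rightarrow> nat \<Rightarrow> 'k::real_normed_field"
  where "line_lift n f g j b = (\<lambda>r. if r \<le> n then g r j b * of_real (sqrt (f r b)) else 0)"

text \<open>The common shape of \<open>w1_map\<close> and \<open>c1_map\<close>, with "b lies in the
  ball of j" replaced by "the weight of j is positive at b".\<close>

definition line_map ::
    "nat \<Rightarrow> (nat \<Rightarrow> 'b \<Rightarrow> real) \<Rightarrow> (nat \<Rightarrow> nat \<Rightarrow> 'b \<Rightarrow> 'k) \<Rightarrow> 'b \<Rightarrow> (nat \<Rightarrow> 'k::real_normed_field) set"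
  where "line_map n f g b = (THE p. \<forall>j\<le>n. 0 < f j b \<longrightarrow> p = homog (line_lift n f g j b))"

text \<open>The data of a line bundle with a partition of unity. Continuity and nonvanishing are
  asked on all of \<open>S\<close>, which the concrete transition functions satisfy; the cocycle
  identity only where three weights are positive, because a cocycle on the nerve provides it only
  there.\<close>

locale line_data =
  fixes n :: nat and S :: "'b::topological_space set"
    and f :: "nat \<Rightarrow> 'b \<Rightarrow> real" and g :: "nat \<Rightarrow> nat \<Rightarrow> 'b \<Rightarrow> 'k::real_normed_field"
  assumes weight_continuous: "\<And>r. r \<le> n \<Longrightarrow> continuous_on S (f r)"
    and weight_nonneg: "\<And>r b. b \<in> S \<Longrightarrow> r \<le> n \<Longrightarrow> 0 \<le> f r b"
    and weight_pos: "\<And>b. b \<in> S \<Longrightarrow> \<exists>j\<le>n. 0 < f j b"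
    and transition_continuous: "\<And>r j. r \<le> n \<Longrightarrow> j \<le> n \<Longrightarrow> continuous_on S (g r j)"
    and transition_nonzero: "\<And>r j b. b \<in> S \<Longrightarrow> r \<le> n \<Longrightarrow> j \<le> n \<Longrightarrow> g r j b \<noteq> 0"
    and transition_cocycle: "\<And>r j k b. b \<in> S \<Longrightarrow> r \<le> n \<Longrightarrow> j \<le> n \<Longrightarrow> k \<le> n \<Longrightarrow>
          0 < f r b \<Longrightarrow> 0 < f j b \<Longrightarrow> 0 < f k b \<Longrightarrow> g r j b * g j k b = g r k b"
begin

lemma homog_line_lift_eq:
  assumes b: "b \<in> S" and j: "j \<le> n" "0 < f j b" and k: "k \<le> n" "0 < f k b"
  shows "homog (line_lift n f g k b) = homog (line_lift n f g j b)"
proof -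
  have "line_lift n f g k b = (\<lambda>r. g j k b * line_lift n f g j b r)"
  proof
    fix r
    show "line_lift n f g k b r = g j k b * line_lift n f g j b r"
    \<comment> \<open>Off the support of the weights both coordinates vanish, so the cocycle
      identity is invoked only where it is assumed.\<close>
    proof (cases "r \<le> n \<and> f r b \<noteq> 0")
      case True
      then have "g r j b * g j k b = g r k b"
        using b j k weight_nonneg[OF b, of r] by (intro transition_cocycle) auto
      then have "g r k b = g j k b * g r j b"
        by (simp only: mult.commute)
      then show ?thesis
        using True by (simp add: line_lift_def mult.assoc)
    qed (auto simp: line_lift_def)
  qed
  then show ?thesis
    using homog_scale[OF transition_nonzero[OF b j(1) k(1)]] by simp
qed

lemma line_map_eq:
  assumes b: "b \<in> S" and j: "j \<le> n" "0 < f j b"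
  shows "line_map n f g b = homog (line_lift n f g j b)"
  unfolding line_map_def
proof (rule the_equality)
  show "\<forall>k\<le>n. 0 < f k b \<longrightarrow> homog (line_lift n f g j b) = homog (line_lift n f g k b)"
    using homog_line_lift_eq[OF b _ _ j] by blast
qed (use j in blast)

lemma continuous_line_lift:
  assumes j: "j \<le> n"
  shows "continuous_map (top_of_set {b \<in> S. 0 < f j b}) (punctured_space n) (line_lift n f g j)"
proof -
  let ?V = "{b \<in> S. 0 < f j b}"
  have c: "continuous_on ?V (\<lambda>b. line_lift n f g j b r)" for r
  proof (cases "r \<le> n")
    case True
    have "continuous_on S (\<lambda>b. g r j b * of_real (sqrt (f r b)))"
      using True j by (intro continuous_intros transition_continuous weight_continuous)
    then have "continuous_on ?V (\<lambda>b. g r j b * of_real (sqrt (f r b)))"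
      by (rule continuous_on_subset) auto
    then show ?thesis
      using True by (simp add: line_lift_def)
  qed (simp add: line_lift_def)
  have nz: "line_lift n f g j b j \<noteq> 0" if "b \<in> ?V" for b
    using that j transition_nonzero[of b j j] by (simp add: line_lift_def)
  have zero: "line_lift n f g j b i = 0" if "n < i" for b i
    using that by (simp add: line_lift_def)
  show ?thesis
    unfolding punctured_space_def continuous_map_in_subtopology continuous_map_componentwise_UNIV
  proof (intro conjI allI)
    show "continuous_map (top_of_set ?V) euclidean (\<lambda>b. line_lift n f g j b r)" for r
      using c by simp
    have "line_lift n f g j b \<in> {z. (\<forall>i>n. z i = 0) \<and> (\<exists>i. z i \<noteq> 0)}" if "b \<in> ?V" for b
      using zero nz[OF that] by blast
    then show "line_lift n f g j \<in> topspace (top_of_set ?V) \<rightarrow> {z. (\<forall>i>n. z i = 0) \<and> (\<exists>i. z i \<noteq> 0)}"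
      by (simp add: Pi_iff)
  qed
qed

lemma continuous_line_map: "continuous_map (top_of_set S) inf_proj_space (line_map n f g)"
proof (rule pasting_lemma[where I="{..n}" and T="\<lambda>j. {b \<in> S. 0 < f j b}"
      and f="\<lambda>j. homog \<circ> line_lift n f g j"])
  fix j assume j: "j \<in> {..n}"
  have "openin (top_of_set S) (S \<inter> f j -` {0<..})"
    using j by (intro continuous_openin_preimage_gen weight_continuous) auto
  then show "openin (top_of_set S) {b \<in> S. 0 < f j b}"
    by (rule back_subst[of "openin _"]) auto
  have "S \<inter> {b \<in> S. 0 < f j b} = {b \<in> S. 0 < f j b}"
    by blast
  then have "subtopology (top_of_set S) {b \<in> S. 0 < f j b} = top_of_set {b \<in> S. 0 < f j b}"
    by (simp only: subtopology_subtopology)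
  then show "continuous_map (subtopology (top_of_set S) {b \<in> S. 0 < f j b}) inf_proj_space
      (homog \<circ> line_lift n f g j)"
    using continuous_map_compose[OF continuous_line_lift continuous_map_homog] j by simp
next
  fix i j b assume "i \<in> {..n}" "j \<in> {..n}"
    "b \<in> topspace (top_of_set S) \<inter> {b \<in> S. 0 < f i b} \<inter> {b \<in> S. 0 < f j b}"
  then show "(homog \<circ> line_lift n f g i) b = (homog \<circ> line_lift n f g j) b"
    by (simp add: homog_line_lift_eq[of b i j])
next
  fix b assume "b \<in> topspace (top_of_set S)"
  then have b: "b \<in> S" by simp
  then obtain j where j: "j \<le> n" "0 < f j b"
    using weight_pos by blast
  then show "\<exists>j. j \<in> {..n} \<and> b \<in> {b \<in> S. 0 < f j b} \<and>
      line_map n f g b = (homog \<circ> line_lift n f g j) b"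
    using line_map_eq[OF b j] b by (intro exI[of _ j]) simp
qed

end

text \<open>Transition functions matter only on the support, where the indices span a simplex and
  cochain identities are available.\<close>

lemma line_map_cong:
  assumes f: "\<And>r. r \<le> n \<Longrightarrow> f r b = f' r b"
    and g: "\<And>r j. r \<le> n \<Longrightarrow> j \<le> n \<Longrightarrow> f r b \<noteq> 0 \<Longrightarrow> 0 < f j b \<Longrightarrow> g r j b = g' r j b"
  shows "line_map n f g b = line_map n f' g' b"
proof -
  have "line_lift n f g j b = line_lift n f' g' j b" if j: "j \<le> n" "0 < f j b" for j
  proof
    fix r
    show "line_lift n f g j b r = line_lift n f' g' j b r"
    proof (cases "r \<le> n \<and> f r b \<noteq> 0")
      case True
      then have "g r j b = g' r j b" "f r b = f' r b"
        using f[of r] g[of r j] j by auto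
      then show ?thesis
        by (simp add: line_lift_def)
    next
      case False
      then show ?thesis
        using f[of r] by (auto simp: line_lift_def)
    qed
  qed
  then have "(\<forall>j\<le>n. 0 < f j b \<longrightarrow> p = homog (line_lift n f g j b)) \<longleftrightarrow>
      (\<forall>j\<le>n. 0 < f' j b \<longrightarrow> p = homog (line_lift n f' g' j b))" for p
    by (simp add: f)
  then show ?thesis
    by (simp only: line_map_def)
qed

text \<open>A homotopy is the same construction over the cylinder; weights and transition functions
  may both vary with the parameter.\<close>

lemma homotopic_line_maps_ends:
  fixes F :: "nat \<Rightarrow> real \<times> 'b::topological_space \<Rightarrow> real"
    and G :: "nat \<Rightarrow> nat \<Rightarrow> real \<times> 'b \<Rightarrow> 'k::real_normed_field"
  assumes "line_data n ({0..1} \<times> S) F G"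
  shows "homotopic_with (\<lambda>_. True) (top_of_set S) inf_proj_space
    (line_map n (\<lambda>r b. F r (0, b)) (\<lambda>r j b. G r j (0, b)))
    (line_map n (\<lambda>r b. F r (1, b)) (\<lambda>r j b. G r j (1, b)))"
  unfolding homotopic_with_def
proof (intro exI conjI allI ballI)
  have "prod_topology (top_of_set {0..1}) (top_of_set S) = top_of_set ({0..1::real} \<times> S)"
    by (simp add: prod_topology_subtopology subtopology_subtopology Times_Int_Times)
  then show "continuous_map (prod_topology (top_of_set {0..1}) (top_of_set S)) inf_proj_space
      (line_map n F G)"
    using line_data.continuous_line_map[OF assms] by simp
  show "line_map n F G (0, b) = line_map n (\<lambda>r b. F r (0, b)) (\<lambda>r j b. G r j (0, b)) b"
    "line_map n F G (1, b) = line_map n (\<lambda>r b. F r (1, b)) (\<lambda>r j b. G r j (1, b)) b" for b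
    by (simp_all only: line_map_def line_lift_def)
qed simp

context line_data
begin

text \<open>Two disjoint copies of the index set carry the weights (1 - u) f and u f. Lifts in
  disjoint coordinates cannot cancel, and conjugating the second copy by \<open>a\<close> preserves
  the cocycle identity, so the shift and the change of gauge happen in one homotopy.\<close>

lemma homotopic_shifted_line_map:
  assumes a: "\<And>r. r \<le> n \<Longrightarrow> continuous_on S (a r)" "\<And>r b. b \<in> S \<Longrightarrow> r \<le> n \<Longrightarrow> a r b \<noteq> 0"
  shows "homotopic_with (\<lambda>_. True) (top_of_set S) inf_proj_space
    (line_map n f g)
    (line_map (2 * n + 1) (\<lambda>r b. if r \<le> n then 0 else f (r - (n + 1)) b)
      (\<lambda>r j b. a (r - (n + 1)) b * g (r - (n + 1)) (j - (n + 1)) b / a (j - (n + 1)) b))"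
proof -
  \<comment> \<open>\<open>e\<close> folds the two copies onto one; \<open>A\<close> is the gauge,
    trivial on the first copy and \<open>a\<close> on the second. The mixed entries of
    \<open>G\<close> glue the two copies together.\<close>
  define e where "e r = (if r \<le> n then r else r - (n + 1))" for r
  define A where "A r b = (if r \<le> n then 1 else a (r - (n + 1)) b)" for r b
  define F where "F r p = (if r \<le> n then 1 - fst p else fst p) * f (e r) (snd p)"
    for r and p :: "real \<times> 'b"
  define G where "G r j p = A r (snd p) * g (e r) (e j) (snd p) / A j (snd p)"
    for r j and p :: "real \<times> 'b"
  have e: "e r \<le> n" if "r \<le> 2 * n + 1" for r
    using that by (auto simp: e_def)
  have A: "continuous_on S (A r)" "\<And>b. b \<in> S \<Longrightarrow> A r b \<noteq> 0" if "r \<le> 2 * n + 1" for r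
    using that a by (cases "r \<le> n"; auto simp: A_def[abs_def])+
  have snd: "continuous_on ({0..1} \<times> S) (\<lambda>p. h (snd p))"
    if "continuous_on S h" for h :: "'b \<Rightarrow> 'z::topological_space"
    using that by (rule continuous_on_compose2) (auto intro: continuous_on_snd)
  have F_pos: "0 < f (e r) (snd p)" if "p \<in> {0..1} \<times> S" "0 < F r p" for r p
    using that by (auto simp: F_def zero_less_mult_iff split: if_splits)
  have "line_data (2 * n + 1) ({0..1} \<times> S) F G"
  proof
    fix r assume r: "r \<le> 2 * n + 1"
    show "continuous_on ({0..1} \<times> S) (F r)"
      unfolding F_def
    proof (rule continuous_on_mult)
      have "continuous_on ({0..1::real} \<times> S) (\<lambda>p. 1 - fst p)" "continuous_on ({0..1::real} \<times> S) (\<lambda>p. fst p)"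
        by (auto intro!: continuous_intros)
      then show "continuous_on ({0..1::real} \<times> S) (\<lambda>p. if r \<le> n then 1 - fst p else fst p)"
        by (cases "r \<le> n") simp_all
    qed (rule snd[OF weight_continuous[OF e[OF r]]])
    fix p :: "real \<times> 'b" assume p: "p \<in> {0..1} \<times> S"
    then show "0 \<le> F r p"
      unfolding F_def using weight_nonneg[OF _ e[OF r], of "snd p"]
      by (intro mult_nonneg_nonneg) auto
  next
    fix p :: "real \<times> 'b" assume p: "p \<in> {0..1} \<times> S"
    then obtain j where j: "j \<le> n" "0 < f j (snd p)"
      using weight_pos[of "snd p"] by auto
    show "\<exists>j\<le>2 * n + 1. 0 < F j p"
    \<comment> \<open>At u = 1 the first copy has weight 0, so the witness moves to the
      second.\<close>
    proof (cases "fst p < 1")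
      case True
      then show ?thesis
        using j by (intro exI[of _ j]) (auto simp: F_def e_def)
    next
      case False
      then show ?thesis
        using j p by (intro exI[of _ "j + (n + 1)"]) (auto simp: F_def e_def)
    qed
  next
    fix r j assume *: "r \<le> 2 * n + 1" "j \<le> 2 * n + 1"
    have "continuous_on S (\<lambda>b. A r b * g (e r) (e j) b / A j b)"
      using * A e by (intro continuous_on_divide continuous_on_mult transition_continuous) auto
    then show "continuous_on ({0..1} \<times> S) (G r j)"
      unfolding G_def by (rule snd)
  next
    fix r j and p :: "real \<times> 'b" assume "p \<in> {0..1} \<times> S" "r \<le> 2 * n + 1" "j \<le> 2 * n + 1"
    then show "G r j p \<noteq> 0"
      unfolding G_def using A(2)[of r "snd p"] A(2)[of j "snd p"] transition_nonzero[of "snd p" "e r" "e j"] e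
      by (auto simp: mem_Times_iff)
  next
    fix r j k and p :: "real \<times> 'b"
    assume *: "p \<in> {0..1} \<times> S" "r \<le> 2 * n + 1" "j \<le> 2 * n + 1" "k \<le> 2 * n + 1"
      "0 < F r p" "0 < F j p" "0 < F k p"
    have cocycle: "g (e r) (e j) (snd p) * g (e j) (e k) (snd p) = g (e r) (e k) (snd p)"
      using * e F_pos[OF *(1)] by (intro transition_cocycle) (simp_all add: mem_Times_iff)
    have "A j (snd p) \<noteq> 0"
      using * A by (simp add: mem_Times_iff)
    then show "G r j p * G j k p = G r k p"
      by (simp add: G_def flip: cocycle)
  qed
  then have hom: "homotopic_with (\<lambda>_. True) (top_of_set S) inf_proj_space
      (line_map (2 * n + 1) (\<lambda>r b. F r (0, b)) (\<lambda>r j b. G r j (0, b)))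
      (line_map (2 * n + 1) (\<lambda>r b. F r (1, b)) (\<lambda>r j b. G r j (1, b)))"
    by (rule homotopic_line_maps_ends)
  \<comment> \<open>\<open>line_map_cong\<close> does not apply, since the index bound drops from
    2n+1 to n; the lifts and their charts are compared directly.\<close>
  have "line_map (2 * n + 1) (\<lambda>r b. F r (0, b)) (\<lambda>r j b. G r j (0, b)) b = line_map n f g b"
    if "b \<in> S" for b
  proof -
    have "line_lift (2 * n + 1) (\<lambda>r b. F r (0, b)) (\<lambda>r j b. G r j (0, b)) j b = line_lift n f g j b"
      if "j \<le> n" for j
      using that by (auto simp: line_lift_def fun_eq_iff F_def G_def e_def A_def)
    moreover have "j \<le> 2 * n + 1 \<and> 0 < F j (0, b) \<longleftrightarrow> j \<le> n \<and> 0 < f j b" for j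
      by (auto simp: F_def e_def)
    ultimately have "(\<forall>j\<le>2 * n + 1. 0 < F j (0, b) \<longrightarrow> p = homog (line_lift (2 * n + 1)
          (\<lambda>r b. F r (0, b)) (\<lambda>r j b. G r j (0, b)) j b)) \<longleftrightarrow>
        (\<forall>j\<le>n. 0 < f j b \<longrightarrow> p = homog (line_lift n f g j b))" for p
      by metis
    then show ?thesis
      by (simp only: line_map_def)
  qed
  moreover have "line_map (2 * n + 1) (\<lambda>r b. F r (1, b)) (\<lambda>r j b. G r j (1, b)) b =
    line_map (2 * n + 1) (\<lambda>r b. if r \<le> n then 0 else f (r - (n + 1)) b)
      (\<lambda>r j b. a (r - (n + 1)) b * g (r - (n + 1)) (j - (n + 1)) b / a (j - (n + 1)) b) b" for b
    by (intro line_map_cong) (auto simp: F_def G_def e_def A_def split: if_splits)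
  ultimately show ?thesis
    by (intro homotopic_with_eq[OF hom]) auto
qed

text \<open>Both maps are homotopic, through \<open>[(1 - u) z : u z']\<close>, to the same map into the
  complementary coordinates.\<close>

lemma homotopic_conjugate_line_map:
  assumes a: "\<And>r. r \<le> n \<Longrightarrow> continuous_on S (a r)" "\<And>r b. b \<in> S \<Longrightarrow> r \<le> n \<Longrightarrow> a r b \<noteq> 0"
  shows "homotopic_with (\<lambda>_. True) (top_of_set S) inf_proj_space
    (line_map n f g) (line_map n f (\<lambda>r j b. a r b * g r j b / a j b))"
proof -
  interpret conj: line_data n S f "\<lambda>r j b. a r b * g r j b / a j b"
  proof
    show "continuous_on S (\<lambda>b. a r b * g r j b / a j b)" if "r \<le> n" "j \<le> n" for r j
      using that a by (intro continuous_intros transition_continuous) auto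
    show "a r b * g r j b / a j b \<noteq> 0" if "b \<in> S" "r \<le> n" "j \<le> n" for r j b
      using that a transition_nonzero[of b r j] by auto
    show "a r b * g r j b / a j b * (a j b * g j k b / a k b) = a r b * g r k b / a k b"
      if "b \<in> S" "r \<le> n" "j \<le> n" "k \<le> n" "0 < f r b" "0 < f j b" "0 < f k b" for r j k b
      using a(2)[of b j] that by (simp flip: transition_cocycle[OF that])
  qed (auto intro: weight_continuous weight_nonneg weight_pos)
  show ?thesis
  proof (rule homotopic_with_trans[OF homotopic_shifted_line_map homotopic_with_symD])
    \<comment> \<open>Shifting the conjugated map with trivial gauge lands on the same map as
      shifting the original one with gauge \<open>a\<close>.\<close>
    show "homotopic_with (\<lambda>_. True) (top_of_set S) inf_proj_space
      (line_map n f (\<lambda>r j b. a r b * g r j b / a j b))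
      (line_map (2 * n + 1) (\<lambda>r b. if r \<le> n then 0 else f (r - (n + 1)) b)
        (\<lambda>r j b. a (r - (n + 1)) b * g (r - (n + 1)) (j - (n + 1)) b / a (j - (n + 1)) b))"
      using conj.homotopic_shifted_line_map[of "\<lambda>_ _. 1"] by simp
  qed (use a in auto)
qed

end

section \<open>Cochains\<close>

lemma alternating_pair:
  "alternating \<phi> [r, s] = (if r = s then 0 else if r < s then \<phi> {r, s} else - \<phi> {r, s})"
proof -
  have "{(i, j). i < j \<and> j < length [r, s] \<and> [r, s] ! j < [r, s] ! i} = (if s < r then {(0, 1)} else {})"
    by (auto simp: less_Suc_eq)
  then show ?thesis
    by (simp add: alternating_def)
qed

lemma alternating_triple:
  "alternating \<phi> [r, s, t] =
     (if r = s \<or> r = t \<or> s = t then 0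
      else (- 1) ^ (of_bool (s < r) + of_bool (t < r) + of_bool (t < s)) * \<phi> {r, s, t})"
proof -
  have "{(i, j). i < j \<and> j < length [r, s, t] \<and> [r, s, t] ! j < [r, s, t] ! i} =
      (if s < r then {(0, 1)} else {}) \<union> (if t < r then {(0, 2)} else {}) \<union>
      (if t < s then {(1, 2)} else {})" (is "?I = _")
    by (auto simp: less_Suc_eq numeral_2_eq_2)
  then have "card ?I = of_bool (s < r) + of_bool (t < r) + of_bool (t < s)"
    by (simp add: card_insert_if)
  then show ?thesis
    by (simp add: alternating_def)
qed

lemma coboundary_0:
  assumes "{x, y} \<in> K" "x < y"
  shows "coboundary K 0 \<phi> {x, y} = \<phi> {y} - \<phi> {x}"
proof -
  have "sorted_list_of_set {x, y} = [x, y]"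
    using sorted_list_of_set.idem_if_sorted_distinct[of "[x, y]"] assms by simp
  moreover have "{x, y} - {x} = {y}" "{x, y} - {y} = {x}"
    using assms by auto
  ultimately show ?thesis
    using assms by (simp add: coboundary_def)
qed

lemma coboundary_1:
  assumes "{x, y, z} \<in> K" "x < y" "y < z"
  shows "coboundary K 1 \<phi> {x, y, z} = \<phi> {y, z} - \<phi> {x, z} + \<phi> {x, y}"
proof -
  have "sorted_list_of_set {x, y, z} = [x, y, z]"
    using sorted_list_of_set.idem_if_sorted_distinct[of "[x, y, z]"] assms by simp
  moreover have "{x, y, z} - {x} = {y, z}" "{x, y, z} - {y} = {x, z}" "{x, y, z} - {z} = {x, y}"
    using assms by auto
  ultimately show ?thesis
    using assms by (simp add: coboundary_def numeral_2_eq_2)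
qed

lemma coboundary_2:
  assumes "{x, y, z, w} \<in> K" "x < y" "y < z" "z < w"
  shows "coboundary K 2 \<phi> {x, y, z, w} = \<phi> {y, z, w} - \<phi> {x, z, w} + \<phi> {x, y, w} - \<phi> {x, y, z}"
proof -
  have "sorted_list_of_set {x, y, z, w} = [x, y, z, w]"
    using sorted_list_of_set.idem_if_sorted_distinct[of "[x, y, z, w]"] assms by simp
  moreover have "{x, y, z, w} - {x} = {y, z, w}" "{x, y, z, w} - {y} = {x, z, w}"
    "{x, y, z, w} - {z} = {x, y, w}" "{x, y, z, w} - {w} = {x, y, z}"
    using assms by auto
  ultimately show ?thesis
    using assms by (simp add: coboundary_def numeral_2_eq_2 numeral_3_eq_3)
qed

lemma alternating_swap:
  "alternating \<phi> [s, r, t] = - alternating \<phi> [r, s, t]"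
  "alternating \<phi> [r, t, s] = - alternating \<phi> [r, s, t]"
  by (auto simp: alternating_triple insert_commute)

text \<open>The defect \<open>D\<close> of the identity changes sign under adjacent transpositions.
  Hence it vanishes on triples with equal neighbours, on increasing triples it is the definition of
  the coboundary, and an insertion sort reaches the general case.\<close>

lemma alternating_coboundary_1:
  assumes "{r, s, t} \<in> K"
  shows "alternating (coboundary K 1 \<phi>) [r, s, t] =
    alternating \<phi> [s, t] - alternating \<phi> [r, t] + alternating \<phi> [r, s]"
proof -
  define D where "D r s t = alternating \<phi> [s, t] - alternating \<phi> [r, t] + alternating \<phi> [r, s]
    - alternating (coboundary K 1 \<phi>) [r, s, t]" for r s t
  have pair: "alternating \<phi> [s, r] = - alternating \<phi> [r, s]" for r s
    by (auto simp: alternating_pair insert_commute)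
  have swap: "D s r t = - D r s t" "D r t s = - D r s t" for r s t
    using alternating_swap[of "coboundary K 1 \<phi>"] pair unfolding D_def by (smt (verit))+
  have sorted: "D x y z = 0" if "{x, y, z} \<in> K" "x \<le> y" "y \<le> z" for x y z
  proof (cases "x = y \<or> y = z")
    case True
    then show ?thesis
      using swap(1)[of x y z] swap(2)[of x y z] by auto
  next
    case False
    then have "x < y" "y < z"
      using that by auto
    then show ?thesis
      using coboundary_1[of x y z K \<phi>] that by (simp add: D_def alternating_triple alternating_pair)
  qed
  have last: "D x y z = 0" if "{x, y, z} \<in> K" "x \<le> y" for x y z
  proof -
    have K: "{x, z, y} \<in> K" "{z, x, y} \<in> K"
      using that(1) by (simp_all add: insert_commute)
    consider "y \<le> z" | "x \<le> z" "z \<le> y" | "z \<le> x"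
      by linarith
    then show ?thesis
      by cases (use sorted[OF that(1)] sorted[OF K(1)] sorted[OF K(2)] that
        swap(2)[of x z y] swap(1)[of z x y] in auto)
  qed
  have "{s, r, t} \<in> K"
    using assms by (simp add: insert_commute)
  then have "D r s t = 0"
    using last[OF assms] last[of s r t] swap(1)[of r s t] by (cases "r \<le> s") auto
  then show ?thesis
    by (simp add: D_def)
qed

text \<open>The same reduction to increasing sequences by insertion sort, one dimension
  higher.\<close>

lemma alternating_cocycle_2:
  assumes "{r, s, t, u} \<in> K" and cocycle: "coboundary K 2 \<phi> = (\<lambda>_. 0)"
  shows "alternating \<phi> [s, t, u] - alternating \<phi> [r, t, u] + alternating \<phi> [r, s, u]
    - alternating \<phi> [r, s, t] = 0"
proof -
  define D where "D r s t u = alternating \<phi> [s, t, u] - alternating \<phi> [r, t, u]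
    + alternating \<phi> [r, s, u] - alternating \<phi> [r, s, t]" for r s t u
  have swap: "D s r t u = - D r s t u" "D r t s u = - D r s t u" "D r s u t = - D r s t u" for r s t u
    using alternating_swap[of \<phi>] unfolding D_def by (smt (verit))+
  have sorted: "D x y z w = 0" if "{x, y, z, w} \<in> K" "x \<le> y" "y \<le> z" "z \<le> w" for x y z w
  proof (cases "x = y \<or> y = z \<or> z = w")
    case True
    then show ?thesis
      using swap(1)[of x y z w] swap(2)[of x y z w] swap(3)[of x y z w] by auto
  next
    case False
    then have "x < y" "y < z" "z < w"
      using that by auto
    then show ?thesis
      using coboundary_2[of x y z w K \<phi>] that cocycle by (simp add: D_def alternating_triple)
  qed
  have last: "D x y z w = 0" if "{x, y, z, w} \<in> K" "x \<le> y" "y \<le> z" for x y z w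
  proof -
    have K: "{x, y, w, z} \<in> K" "{x, w, y, z} \<in> K" "{w, x, y, z} \<in> K"
      using that(1) by (simp_all add: insert_commute)
    consider "z \<le> w" | "y \<le> w" "w \<le> z" | "x \<le> w" "w \<le> y" | "w \<le> x"
      by linarith
    then show ?thesis
      by cases (use sorted[OF that(1)] sorted[OF K(1)] sorted[OF K(2)] sorted[OF K(3)] that
        swap(3)[of x y w z] swap(2)[of x w y z] swap(1)[of w x y z] in auto)
  qed
  have mid: "D x y z w = 0" if "{x, y, z, w} \<in> K" "x \<le> y" for x y z w
  proof -
    have K: "{x, z, y, w} \<in> K" "{z, x, y, w} \<in> K"
      using that(1) by (simp_all add: insert_commute)
    consider "y \<le> z" | "x \<le> z" "z \<le> y" | "z \<le> x"
      by linarith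
    then show ?thesis
      by cases (use last[OF that(1)] last[OF K(1)] last[OF K(2)] that
        swap(2)[of x z y w] swap(1)[of z x y w] in auto)
  qed
  have "{s, r, t, u} \<in> K"
    using assms(1) by (simp add: insert_commute)
  then have "D r s t u = 0"
    using mid[OF assms(1)] mid[of s r t u] swap(1)[of r s t u] by (cases "r \<le> s") auto
  then show ?thesis
    by (simp add: D_def)
qed

section \<open>Restriction of cochains to subcomplexes\<close>

definition face_closed :: "nat set set \<Rightarrow> bool" where
  "face_closed K \<longleftrightarrow> (\<forall>A\<in>K. finite A \<and> (\<forall>B. B \<subseteq> A \<longrightarrow> B \<noteq> {} \<longrightarrow> B \<in> K))"

lemma coboundary_add: "coboundary K k (\<lambda>A. \<phi> A + \<psi> A) A = coboundary K k \<phi> A + coboundary K k \<psi> A"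
  by (simp add: coboundary_def algebra_simps sum.distrib)

lemma coboundary_diff: "coboundary K k (\<lambda>A. \<phi> A - \<psi> A) A = coboundary K k \<phi> A - coboundary K k \<psi> A"
  by (simp add: coboundary_def algebra_simps sum_subtractf)

lemma coboundary_of_int:
  "coboundary K k (\<lambda>A. of_int (\<phi> A)) A = of_int (coboundary K k \<phi> A)"
  by (simp add: coboundary_def)

lemma coboundaries_add:
  assumes "\<phi> \<in> coboundaries K k" "\<psi> \<in> coboundaries K k"
  shows "(\<lambda>A. \<phi> A + \<psi> A) \<in> coboundaries K k"
proof (cases k)
  case 0
  then show ?thesis using assms by (simp add: coboundaries_def)
next
  case (Suc l)
  then obtain \<phi>' \<psi>' where "\<phi> = coboundary K l \<phi>'" "\<psi> = coboundary K l \<psi>'" "\<phi>' \<in> cochains K l" "\<psi>' \<in> cochains K l"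
    using assms by (auto simp: coboundaries_def)
  then show ?thesis
    using Suc by (auto simp: coboundaries_def cochains_def coboundary_add[symmetric] fun_eq_iff
        intro!: image_eqI[of _ _ "\<lambda>A. \<phi>' A + \<psi>' A"])
qed

lemma coboundaries_0: "(\<lambda>_. 0) \<in> coboundaries K k"
  by (cases k) (auto simp: coboundaries_def cochains_def coboundary_def fun_eq_iff
      intro!: image_eqI[of _ _ "\<lambda>_. 0"])

lemma coboundaries_diff:
  assumes "\<phi> \<in> coboundaries K k" "\<psi> \<in> coboundaries K k"
  shows "(\<lambda>A. \<phi> A - \<psi> A) \<in> coboundaries K k"
proof (cases k)
  case 0
  then show ?thesis using assms by (simp add: coboundaries_def)
next
  case (Suc l)
  then obtain \<phi>' \<psi>' where "\<phi> = coboundary K l \<phi>'" "\<psi> = coboundary K l \<psi>'" "\<phi>' \<in> cochains K l" "\<psi>' \<in> cochains K l"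
    using assms by (auto simp: coboundaries_def)
  then show ?thesis
    using Suc by (auto simp: coboundaries_def cochains_def coboundary_diff[symmetric] fun_eq_iff
        intro!: image_eqI[of _ _ "\<lambda>A. \<phi>' A - \<psi>' A"])
qed

lemma equiv_cohomologous: "equiv (cocycles K k) (cohomologous K k)"
proof (rule equivI)
  show "cohomologous K k \<subseteq> cocycles K k \<times> cocycles K k"
    by (auto simp: cohomologous_def)
  show "refl_on (cocycles K k) (cohomologous K k)"
    by (auto simp: refl_on_def cohomologous_def coboundaries_0)
  show "sym (cohomologous K k)"
    unfolding sym_def cohomologous_def using coboundaries_diff[OF coboundaries_0] by auto fastforce
  show "trans (cohomologous K k)"
    unfolding trans_def cohomologous_def using coboundaries_add by auto fastforce
qed

text \<open>Faces of a simplex of \<open>L\<close> lie in \<open>L\<close>, so the coboundary there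
  never sees the values that were set to zero.\<close>

lemma coboundary_restrict:
  assumes "L \<subseteq> K" "face_closed L"
  shows "coboundary L k (\<lambda>A. if A \<in> L then \<phi> A else 0) =
    (\<lambda>A. if A \<in> L then coboundary K k \<phi> A else 0)"
proof
  fix A
  have "A - {sorted_list_of_set A ! j} \<in> L" if A: "A \<in> L" "card A = k + 2" for j
  proof -
    \<comment> \<open>Closure under faces covers nonempty faces only; here at least k + 1 vertices
      remain.\<close>
    have "A - {sorted_list_of_set A ! j} \<noteq> {}"
    proof
      assume "A - {sorted_list_of_set A ! j} = {}"
      then have "card A \<le> card {sorted_list_of_set A ! j}"
        by (intro card_mono) auto
      then show False using A by simp
    qed
    then show ?thesis
      using A assms(2) by (auto simp: face_closed_def)
  qed
  then show "coboundary L k (\<lambda>A. if A \<in> L then \<phi> A else 0) A = (if A \<in> L then coboundary K k \<phi> A else 0)"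
    using assms(1) by (auto simp: coboundary_def intro!: sum.cong)
qed

lemma restrict_cocycles:
  assumes "L \<subseteq> K" "face_closed L" "\<phi> \<in> cocycles K k"
  shows "(\<lambda>A. if A \<in> L then \<phi> A else 0) \<in> cocycles L k"
  using assms(3) coboundary_restrict[OF assms(1,2), of k \<phi>] by (auto simp: cocycles_def cochains_def)

lemma restrict_cohomologous:
  assumes L: "L \<subseteq> K" "face_closed L" and "(\<phi>, \<psi>) \<in> cohomologous K k"
  shows "((\<lambda>A. if A \<in> L then \<phi> A else 0), (\<lambda>A. if A \<in> L then \<psi> A else 0)) \<in> cohomologous L k"
proof -
  have "(\<lambda>A. (if A \<in> L then \<phi> A else 0) - (if A \<in> L then \<psi> A else 0)) \<in> coboundaries L k"
  proof (cases k)
    case 0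
    then have "\<phi> A - \<psi> A = 0" for A
      using assms(3) by (auto simp: cohomologous_def coboundaries_def fun_eq_iff)
    then show ?thesis
      using 0 by (auto simp: coboundaries_def fun_eq_iff)
  next
    case (Suc l)
    then obtain \<rho> where "\<rho> \<in> cochains K l" "(\<lambda>A. \<phi> A - \<psi> A) = coboundary K l \<rho>"
      using assms(3) by (auto simp: cohomologous_def coboundaries_def)
    then have "(\<lambda>A. if A \<in> L then \<rho> A else 0) \<in> cochains L l"
      "(\<lambda>A. (if A \<in> L then \<phi> A else 0) - (if A \<in> L then \<psi> A else 0)) =
        coboundary L l (\<lambda>A. if A \<in> L then \<rho> A else 0)"
      unfolding coboundary_restrict[OF L] by (auto simp: cochains_def fun_eq_iff)
    then show ?thesis
      using Suc by (auto simp: coboundaries_def)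
  qed
  then show ?thesis
    using assms(3) restrict_cocycles[OF L, of _ k] by (auto simp: cohomologous_def)
qed

text \<open>The union over representatives collapses: all its members coincide, and
  \<open>\<phi>\<close> itself keeps the index set nonempty. The other class maps are evaluated in
  the same way.\<close>

lemma restrict_cohomology_class:
  assumes "L \<subseteq> K" "face_closed L" "\<phi> \<in> cocycles K k"
  shows "restrict_cohomology L k (cohomologous K k `` {\<phi>}) =
    cohomologous L k `` {\<lambda>A. if A \<in> L then \<phi> A else 0}"
proof -
  have "restrict_cohomology L k (cohomologous K k `` {\<phi>}) =
      (\<Union>\<psi>\<in>cohomologous K k `` {\<phi>}. cohomologous L k `` {\<lambda>A. if A \<in> L then \<phi> A else 0})"
    unfolding restrict_cohomology_def
  proof (rule SUP_cong[OF refl])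
    fix \<psi> assume "\<psi> \<in> cohomologous K k `` {\<phi>}"
    then show "cohomologous L k `` {\<lambda>A. if A \<in> L then \<psi> A else 0} =
        cohomologous L k `` {\<lambda>A. if A \<in> L then \<phi> A else 0}"
      using equiv_class_eq[OF equiv_cohomologous restrict_cohomologous[OF assms(1,2)], of \<phi> \<psi>] by simp
  qed
  moreover have "\<phi> \<in> cohomologous K k `` {\<phi>}"
    using equiv_class_self[OF equiv_cohomologous assms(3)] .
  ultimately show ?thesis
    by auto
qed

lemma restrict_cohomology_in:
  assumes "L \<subseteq> K" "face_closed L" "c \<in> cohomology K k"
  shows "restrict_cohomology L k c \<in> cohomology L k"
proof -
  obtain \<phi> where \<phi>: "\<phi> \<in> cocycles K k" "c = cohomologous K k `` {\<phi>}"
    using assms(3) unfolding cohomology_def by (rule quotientE)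
  show ?thesis
    unfolding \<phi>(2) restrict_cohomology_class[OF assms(1,2) \<phi>(1)]
    using restrict_cocycles[OF assms(1,2) \<phi>(1)] by (simp add: cohomology_def quotientI)
qed

section \<open>Orthogonal projection and harmonic representatives\<close>

text \<open>Gram-Schmidt: adding \<open>v e\<^sub>0\<close> to the family changes the projection of \<open>x\<close> by the projection
  of the residual onto the part of \<open>v e\<^sub>0\<close> that is orthogonal to the old family.\<close>

lemma orthogonal_residual_exists:
  fixes v :: "'e \<Rightarrow> 'i \<Rightarrow> real"
  assumes "finite E" "finite S"
  shows "\<exists>c. \<forall>e\<in>E. (\<Sum>i\<in>S. (x i - (\<Sum>e'\<in>E. c e' * v e' i)) * v e i) = 0"
  using assms(1)
proof (induction E arbitrary: x)
  case (insert e0 E)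
  obtain c where c: "\<And>e. e \<in> E \<Longrightarrow> (\<Sum>i\<in>S. (x i - (\<Sum>e'\<in>E. c e' * v e' i)) * v e i) = 0"
    using insert.IH by blast
  \<comment> \<open>The induction hypothesis is used a second time, with \<open>v e0\<close> in
    place of \<open>x\<close>; hence \<open>x\<close> is generalized in the induction.\<close>
  obtain d where d: "\<And>e. e \<in> E \<Longrightarrow> (\<Sum>i\<in>S. (v e0 i - (\<Sum>e'\<in>E. d e' * v e' i)) * v e i) = 0"
    using insert.IH by blast
  define y where "y i = x i - (\<Sum>e'\<in>E. c e' * v e' i)" for i
  define w where "w i = v e0 i - (\<Sum>e'\<in>E. d e' * v e' i)" for i
  define k where "k = (\<Sum>i\<in>S. y i * w i) / (\<Sum>i\<in>S. w i * w i)"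
  define c' where "c' e = (if e = e0 then k else c e - k * d e)" for e
  have residual: "x i - (\<Sum>e'\<in>insert e0 E. c' e' * v e' i) = y i - k * w i" for i
  proof -
    have "(\<Sum>e'\<in>E. c' e' * v e' i) = (\<Sum>e'\<in>E. c e' * v e' i - k * (d e' * v e' i))"
      using insert.hyps by (intro sum.cong) (auto simp: c'_def algebra_simps)
    then show ?thesis
      using insert.hyps by (simp add: c'_def y_def w_def sum_subtractf sum_distrib_left algebra_simps)
  qed
  have old: "(\<Sum>i\<in>S. (y i - k * w i) * v e i) = 0" if "e \<in> E" for e
  proof -
    have "(\<Sum>i\<in>S. (y i - k * w i) * v e i) = (\<Sum>i\<in>S. y i * v e i) - k * (\<Sum>i\<in>S. w i * v e i)"
      by (simp add: algebra_simps sum_subtractf sum_distrib_left)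
    then show ?thesis
      using c[OF that] d[OF that] by (simp add: y_def w_def)
  qed
  have w: "(\<Sum>i\<in>S. (y i - k * w i) * w i) = 0"
  \<comment> \<open>In the degenerate case \<open>v e0\<close> adds no new direction on
    \<open>S\<close>: \<open>w\<close> vanishes there and the quotient \<open>k\<close> is 0 by
    convention.\<close>
  proof (cases "(\<Sum>i\<in>S. w i * w i) = 0")
    case True
    then have "\<forall>i\<in>S. w i * w i = 0"
      using assms(2) by (subst (asm) sum_nonneg_eq_0_iff) auto
    then show ?thesis by simp
  next
    case False
    have "(\<Sum>i\<in>S. (y i - k * w i) * w i) = (\<Sum>i\<in>S. y i * w i) - k * (\<Sum>i\<in>S. w i * w i)"
      by (simp add: algebra_simps sum_subtractf sum_distrib_left)
    then show ?thesis
      using False by (simp add: k_def)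
  qed
  \<comment> \<open>\<open>v e0\<close> is \<open>w\<close> plus a combination of the old family,
    and the new residual is orthogonal to both.\<close>
  have "(\<Sum>i\<in>S. (y i - k * w i) * v e0 i) =
      (\<Sum>i\<in>S. (y i - k * w i) * w i + (\<Sum>e\<in>E. d e * ((y i - k * w i) * v e i)))"
  proof (rule sum.cong[OF refl])
    fix i
    have v: "v e0 i = w i + (\<Sum>e\<in>E. d e * v e i)"
      by (simp add: w_def)
    show "(y i - k * w i) * v e0 i =
        (y i - k * w i) * w i + (\<Sum>e\<in>E. d e * ((y i - k * w i) * v e i))"
      by (simp only: v distrib_left sum_distrib_left mult.left_commute)
  qed
  also have "\<dots> = (\<Sum>i\<in>S. (y i - k * w i) * w i) + (\<Sum>e\<in>E. d e * (\<Sum>i\<in>S. (y i - k * w i) * v e i))"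
    unfolding sum.distrib sum_distrib_left by (intro arg_cong2[of _ _ _ _ "(+)"] refl sum.swap)
  also have "\<dots> = 0"
    using w old by simp
  finally show ?case
    using residual old by (intro exI[of _ c']) auto
qed simp

text \<open>This makes the difference of a 2-cocycle and \<open>coboundary K 1 \<nu>\<close> a
  cocycle again. All faces of a 3-simplex lie in \<open>K\<close>, and their edge terms cancel in
  pairs.\<close>

lemma coboundary_coboundary:
  assumes K: "face_closed K"
  shows "coboundary K 2 (coboundary K 1 \<phi>) = (\<lambda>_. 0)"
proof
  fix A
  show "coboundary K 2 (coboundary K 1 \<phi>) A = 0"
  proof (cases "A \<in> K \<and> card A = 4")
    case True
    have "\<exists>x y z w. xs = [x, y, z, w]" if "length xs = 4" for xs :: "nat list"
      using that by (auto simp: numeral_eq_Suc length_Suc_conv)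
    moreover have "finite A"
      using K True by (auto simp: face_closed_def)
    moreover have "length (sorted_list_of_set A) = 4"
      using True by simp
    ultimately obtain x y z w where l: "sorted_list_of_set A = [x, y, z, w]"
      by blast
    then have A: "A = {x, y, z, w}"
      using set_sorted_list_of_set[OF \<open>finite A\<close>] by simp
    have "sorted_wrt (<) [x, y, z, w]"
      using strict_sorted_list_of_set[of A] l by simp
    then have less: "x < y" "y < z" "z < w"
      by auto
    have "{y, z, w} \<in> K" "{x, z, w} \<in> K" "{x, y, w} \<in> K" "{x, y, z} \<in> K"
      using True K unfolding A face_closed_def by auto
    then show ?thesis
      using True less unfolding A by (simp add: coboundary_2 coboundary_1[unfolded One_nat_def])
  qed (auto simp: coboundary_def)
qed

text \<open>Presents the coboundaries as the span of a finite family indexed by the edges, the form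
  to which the projection lemma applies.\<close>

lemma coboundary_1_expand:
  fixes \<phi> :: "nat set \<Rightarrow> 'a::comm_ring_1"
  assumes "finite K" "\<phi> \<in> cochains K 1"
  shows "coboundary K 1 \<phi> A =
    (\<Sum>e | e \<in> K \<and> card e = 2. \<phi> e * coboundary K 1 (\<lambda>B. of_bool (B = e)) A)"
proof (cases "A \<in> K \<and> card A = 3")
  case True
  have eq: "\<phi> B = (\<Sum>e | e \<in> K \<and> card e = 2. \<phi> e * of_bool (B = e))" for B
  proof -
    have "(\<Sum>e | e \<in> K \<and> card e = 2. \<phi> e * of_bool (B = e)) =
        (\<Sum>e | e \<in> K \<and> card e = 2. if e = B then \<phi> e else 0)"
      by (intro sum.cong) auto
    also have "\<dots> = \<phi> B"
      using assms by (subst sum.delta) (auto simp: cochains_def numeral_2_eq_2)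
    finally show ?thesis by simp
  qed
  have unfold: "coboundary K 1 \<psi> A = (\<Sum>j\<le>2. (- 1) ^ j * \<psi> (A - {sorted_list_of_set A ! j}))" for \<psi> :: "nat set \<Rightarrow> 'a"
    using True by (simp add: coboundary_def numeral_2_eq_2)
  have "coboundary K 1 \<phi> A = (\<Sum>j\<le>2. (- 1) ^ j * \<phi> (A - {sorted_list_of_set A ! j}))"
    by (rule unfold)
  also have "\<dots> = (\<Sum>j\<le>2. (- 1) ^ j * (\<Sum>e | e \<in> K \<and> card e = 2.
      \<phi> e * of_bool (A - {sorted_list_of_set A ! j} = e)))"
    by (simp only: eq[symmetric])
  also have "\<dots> = (\<Sum>j\<le>2. \<Sum>e | e \<in> K \<and> card e = 2.
      \<phi> e * ((- 1) ^ j * of_bool (A - {sorted_list_of_set A ! j} = e)))"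
    by (simp add: sum_distrib_left algebra_simps)
  also have "\<dots> = (\<Sum>e | e \<in> K \<and> card e = 2. \<Sum>j\<le>2.
      \<phi> e * ((- 1) ^ j * of_bool (A - {sorted_list_of_set A ! j} = e)))"
    by (rule sum.swap)
  finally show ?thesis
    by (simp only: unfold sum_distrib_left)
qed (auto simp: coboundary_def)

text \<open>The harmonic representative is the least-squares residual of \<open>\<eta>\<close> with
  respect to the coboundaries of the edge indicators; the coefficients of the projection are the
  values of \<open>\<nu>\<close>.\<close>

lemma harmonic_representative_exists:
  fixes \<eta> :: "nat set \<Rightarrow> real"
  assumes K: "finite K" "face_closed K" and \<eta>: "\<eta> \<in> cocycles K 2"
  obtains \<nu> where "\<nu> \<in> cochains K 1" "harmonic K 2 (\<lambda>A. \<eta> A - coboundary K 1 \<nu> A)"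
proof -
  define E where "E = {e. e \<in> K \<and> card e = 2}"
  define S where "S = {A. A \<in> K \<and> card A = 3}"
  define v where "v e A = (coboundary K 1 (\<lambda>B. of_bool (B = e)) A :: real)" for e A
  have fin: "finite E" "finite S"
    using K by (auto simp: E_def S_def)
  obtain c where c: "\<And>e. e \<in> E \<Longrightarrow> (\<Sum>A\<in>S. (\<eta> A - (\<Sum>e'\<in>E. c e' * v e' A)) * v e A) = 0"
    using orthogonal_residual_exists[OF fin, of \<eta> v] by blast
  define \<nu> where "\<nu> e = (if e \<in> E then c e else 0)" for e
  have \<nu>: "\<nu> \<in> cochains K 1"
    by (auto simp: cochains_def \<nu>_def E_def)
  have expand: "coboundary K 1 \<phi> A = (\<Sum>e\<in>E. \<phi> e * v e A)" if "\<phi> \<in> cochains K 1" for \<phi> A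
    using coboundary_1_expand[OF K(1) that] by (simp add: E_def v_def)
  have \<delta>\<nu>: "coboundary K 1 \<nu> A = (\<Sum>e\<in>E. c e * v e A)" for A
    unfolding expand[OF \<nu>] by (intro sum.cong) (auto simp: \<nu>_def)
  have "(\<Sum>A\<in>S. (\<eta> A - coboundary K 1 \<nu> A) * coboundary K 1 \<psi> A) = 0" if "\<psi> \<in> cochains K 1" for \<psi>
  proof -
    have "(\<Sum>A\<in>S. (\<eta> A - coboundary K 1 \<nu> A) * coboundary K 1 \<psi> A) =
        (\<Sum>A\<in>S. \<Sum>e\<in>E. \<psi> e * ((\<eta> A - (\<Sum>e'\<in>E. c e' * v e' A)) * v e A))"
      unfolding \<delta>\<nu> expand[OF that] by (simp add: sum_distrib_left mult.left_commute)
    also have "\<dots> = (\<Sum>e\<in>E. \<psi> e * (\<Sum>A\<in>S. (\<eta> A - (\<Sum>e'\<in>E. c e' * v e' A)) * v e A))"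
      by (subst sum.swap) (simp only: sum_distrib_left)
    finally show ?thesis
      using c by simp
  qed
  moreover have "(\<lambda>A. \<eta> A - coboundary K 1 \<nu> A) \<in> cocycles K 2"
  proof -
    have "coboundary K 2 (\<lambda>A. \<eta> A - coboundary K 1 \<nu> A) = (\<lambda>_. 0)"
      using \<eta> coboundary_coboundary[OF K(2), of \<nu>]
      by (simp add: cocycles_def coboundary_diff fun_eq_iff)
    then show ?thesis
      using \<eta> by (auto simp: cocycles_def cochains_def coboundary_def)
  qed
  moreover have "(coboundaries K 2 :: (nat set \<Rightarrow> real) set) = coboundary K 1 ` cochains K 1"
    by (simp add: coboundaries_def numeral_2_eq_2)
  ultimately have "harmonic K 2 (\<lambda>A. \<eta> A - coboundary K 1 \<nu> A)"
    by (auto simp: harmonic_def S_def)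
  then show ?thesis
    using that \<nu> by blast
qed

section \<open>Transition functions of cocycles\<close>

text \<open>Partitions of unity on \<open>S\<close> subordinate to a cover whose nerve is contained in \<open>K\<close>.\<close>

locale simplicial_weights =
  fixes n :: nat and K :: "nat set set" and S :: "'b::topological_space set"
    and f :: "nat \<Rightarrow> 'b \<Rightarrow> real"
  assumes weight_continuous: "\<And>r. r \<le> n \<Longrightarrow> continuous_on S (f r)"
    and weight_nonneg: "\<And>r b. b \<in> S \<Longrightarrow> r \<le> n \<Longrightarrow> 0 \<le> f r b"
    and weight_sum: "\<And>b. b \<in> S \<Longrightarrow> (\<Sum>r = 0..n. f r b) = 1"
    and support_simplex: "\<And>b. b \<in> S \<Longrightarrow> {r. r \<le> n \<and> 0 < f r b} \<in> K"
begin

lemma weight_pos: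
  assumes "b \<in> S"
  shows "\<exists>j\<le>n. 0 < f j b"
proof (rule ccontr)
  assume "\<not> ?thesis"
  then have "(\<Sum>r = 0..n. f r b) \<le> 0"
    by (intro sum_nonpos) (auto simp: not_less)
  then show False
    using weight_sum[OF assms] by simp
qed

lemma support_face:
  assumes "face_closed K" "b \<in> S" "A \<noteq> {}" "\<And>r. r \<in> A \<Longrightarrow> r \<le> n \<and> 0 < f r b"
  shows "A \<in> K"
proof -
  have "A \<subseteq> {r. r \<le> n \<and> 0 < f r b}"
    using assms(4) by blast
  then show ?thesis
    using support_simplex[OF assms(2)] assms(1,3) unfolding face_closed_def by blast
qed

text \<open>Cochain identities hold on simplices only. Vertices off the support enter with weight 0,
  so identities on the support suffice under the sum.\<close>

lemma weighted_sum_cong: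
  assumes "b \<in> S" "\<And>t. t \<le> n \<Longrightarrow> 0 < f t b \<Longrightarrow> u t = v t"
  shows "(\<Sum>t = 0..n. f t b * u t) = (\<Sum>t = 0..n. f t b * v t)"
proof (rule sum.cong[OF refl])
  fix t assume "t \<in> {0..n}"
  then show "f t b * u t = f t b * v t"
    using assms weight_nonneg[of b t] by (cases "f t b = 0") auto
qed

end

section \<open>Signs from mod 2 cocycles, phases from integral cocycles\<close>

definition bit_sign :: "bit \<Rightarrow> real" where
  "bit_sign x = (if x = 0 then 1 else - 1)"

text \<open>The case r = j realizes the convention that the diagonal entries of
  \<open>\<tau>\<close> vanish; the set {r, r} would be a vertex and not an edge.\<close>

definition sign_transition :: "(nat set \<Rightarrow> bit) \<Rightarrow> nat \<Rightarrow> nat \<Rightarrow> real" where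
  "sign_transition \<tau> r j = (if r = j then 1 else bit_sign (\<tau> {r, j}))"

lemma bit_sign_nonzero: "bit_sign x \<noteq> 0"
  by (simp add: bit_sign_def)

lemma sign_transition_cocycle:
  assumes \<tau>: "coboundary K 1 \<tau> = (\<lambda>_. 0)" and "{r, j, k} \<in> K"
  shows "sign_transition \<tau> r j * sign_transition \<tau> j k = sign_transition \<tau> r k"
proof (cases "r = j \<or> j = k \<or> r = k")
  case True
  then show ?thesis
    by (auto simp: sign_transition_def bit_sign_def insert_commute)
next
  case False
  \<comment> \<open>Unlike the claim, the product of the three signs is symmetric in the vertices,
    so increasing order suffices. A sign is its own inverse, so one factor can be moved across
    afterwards.\<close>
  have sorted: "bit_sign (\<tau> {x, y}) * bit_sign (\<tau> {y, z}) * bit_sign (\<tau> {x, z}) = 1"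
    if "{x, y, z} = {r, j, k}" "x < y" "y < z" for x y z
  proof -
    have "\<tau> {y, z} + \<tau> {x, z} + \<tau> {x, y} = 0"
      using coboundary_1[of x y z K \<tau>] that \<tau> assms(2) by simp
    then show ?thesis
      by (cases "\<tau> {x, y}"; cases "\<tau> {y, z}"; cases "\<tau> {x, z}") (auto simp: bit_sign_def)
  qed
  consider "r < j" "j < k" | "r < k" "k < j" | "j < r" "r < k" | "j < k" "k < r" | "k < r" "r < j" | "k < j" "j < r"
    using False by linarith
  then have "bit_sign (\<tau> {r, j}) * bit_sign (\<tau> {j, k}) * bit_sign (\<tau> {r, k}) = 1"
    by cases (use sorted[of r j k] sorted[of r k j] sorted[of j r k] sorted[of j k r]
        sorted[of k r j] sorted[of k j r] in \<open>auto simp: insert_commute mult_ac\<close>)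
  then have "bit_sign (\<tau> {r, j}) * bit_sign (\<tau> {j, k}) = bit_sign (\<tau> {r, k})"
    by (auto simp: bit_sign_def split: if_splits)
  then show ?thesis
    using False by (simp add: sign_transition_def)
qed

text \<open>Written with a quotient of signs to match the conjugation in
  \<open>homotopic_conjugate_line_map\<close>.\<close>

lemma sign_transition_gauge:
  assumes "\<And>A. \<tau> A - \<tau>' A = coboundary K 0 \<rho> A" "{r, j} \<in> K"
  shows "sign_transition \<tau> r j = bit_sign (\<rho> {r}) * sign_transition \<tau>' r j / bit_sign (\<rho> {j})"
proof -
  have sorted: "bit_sign (\<tau> {x, y}) = bit_sign (\<rho> {x}) * bit_sign (\<tau>' {x, y}) / bit_sign (\<rho> {y})"
    if "{x, y} \<in> K" "x < y" for x y
  proof -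
    have "\<tau> {x, y} + \<tau>' {x, y} = \<rho> {y} + \<rho> {x}"
      using assms(1)[of "{x, y}"] coboundary_0[OF that, of \<rho>] by simp
    then show ?thesis
      by (cases "\<tau> {x, y}"; cases "\<tau>' {x, y}"; cases "\<rho> {x}"; cases "\<rho> {y}")
        (auto simp: bit_sign_def)
  qed
  consider "r = j" | "r < j" | "j < r"
    by linarith
  then show ?thesis
  proof cases
    case 1
    then show ?thesis by (simp add: sign_transition_def bit_sign_nonzero)
  next
    case 2
    then show ?thesis using sorted[OF assms(2)] by (simp add: sign_transition_def)
  next
    case 3
    have "{j, r} \<in> K"
      using assms(2) by (simp add: insert_commute)
    then show ?thesis
      using sorted[of j r] 3 by (simp add: sign_transition_def insert_commute bit_sign_def split: if_splits)
  qed
qed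

definition phase :: "real \<Rightarrow> complex" where
  "phase x = cis (2 * pi * x)"

lemma phase_add: "phase (x + y) = phase x * phase y"
  by (simp add: phase_def cis_mult distrib_left)

lemma phase_diff: "phase (x - y) = phase x / phase y"
  by (simp add: phase_def cis_divide right_diff_distrib)

lemma phase_Ints: "x \<in> \<int> \<Longrightarrow> phase x = 1"
  by (simp add: phase_def cis_multiple_2pi)

lemma phase_nonzero [simp]: "phase x \<noteq> 0"
  by (simp add: phase_def)

lemma continuous_on_phase [continuous_intros]:
  "continuous_on S h \<Longrightarrow> continuous_on S (\<lambda>x. phase (h x))"
  unfolding phase_def by (intro continuous_intros)

lemma alternating_Ints: "(\<And>A. \<phi> A \<in> \<int>) \<Longrightarrow> alternating \<phi> vs \<in> \<int>"
  by (auto simp: alternating_def intro!: Ints_mult Ints_power)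

text \<open>The cochain h_rj = sum_t w_t \<eta>_rjt is the standard primitive of \<eta> built from a
  partition of unity: its coboundary is \<eta>. As \<eta> is integral, exp(2 pi i h) is a
  circle-valued 1-cocycle.\<close>

definition phase_transition ::
    "nat \<Rightarrow> (nat set \<Rightarrow> int) \<Rightarrow> (nat \<Rightarrow> real) \<Rightarrow> nat \<Rightarrow> nat \<Rightarrow> complex" where
  "phase_transition n \<eta> w r j =
     phase (\<Sum>t = 0..n. w t * alternating (\<lambda>A. real_of_int (\<eta> A)) [r, j, t])"

context simplicial_weights
begin

lemma line_data_sign:
  assumes "face_closed K" "\<tau> \<in> cocycles K 1"
  shows "line_data n S f (\<lambda>r j _. sign_transition \<tau> r j)"
proof
  fix r j k b
  assume *: "b \<in> S" "r \<le> n" "j \<le> n" "k \<le> n" "0 < f r b" "0 < f j b" "0 < f k b"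
  then have "{r, j, k} \<in> K"
    using support_face[OF assms(1), of b "{r, j, k}"] by auto
  then show "sign_transition \<tau> r j * sign_transition \<tau> j k = sign_transition \<tau> r k"
    using assms(2) by (intro sign_transition_cocycle[of K]) (auto simp: cocycles_def)
qed (auto simp: sign_transition_def bit_sign_nonzero weight_pos weight_nonneg weight_continuous)

text \<open>Averaging the cocycle identity on {r, j, k, t} over t leaves the defect \<eta>_rjk in
  the exponent, because the weights sum to 1. This is an integer, which \<open>phase\<close> sends
  to 1.\<close>

lemma line_data_phase:
  assumes "face_closed K" "\<eta> \<in> cocycles K 2"
  shows "line_data n S f (\<lambda>r j b. phase_transition n \<eta> (\<lambda>t. f t b) r j)"
proof
  let ?a = "alternating (\<lambda>A. real_of_int (\<eta> A))"
  fix r j k b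
  assume *: "b \<in> S" "r \<le> n" "j \<le> n" "k \<le> n" "0 < f r b" "0 < f j b" "0 < f k b"
  have zero: "coboundary K 2 (\<lambda>A. real_of_int (\<eta> A)) = (\<lambda>_. 0)"
    using assms(2) by (auto simp: coboundary_of_int cocycles_def)
  have "(\<Sum>t = 0..n. f t b * (?a [r, j, t] + ?a [j, k, t])) =
      (\<Sum>t = 0..n. f t b * (?a [r, k, t] + ?a [r, j, k]))"
  proof (rule weighted_sum_cong[OF *(1)])
    fix t assume "t \<le> n" "0 < f t b"
    then have "{r, j, k, t} \<in> K"
      using support_face[OF assms(1) *(1), of "{r, j, k, t}"] * by auto
    from alternating_cocycle_2[OF this zero]
    show "?a [r, j, t] + ?a [j, k, t] = ?a [r, k, t] + ?a [r, j, k]"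
      by simp
  qed
  then have "(\<Sum>t = 0..n. f t b * ?a [r, j, t]) + (\<Sum>t = 0..n. f t b * ?a [j, k, t]) =
      (\<Sum>t = 0..n. f t b * ?a [r, k, t]) + ?a [r, j, k]"
    using weight_sum[OF *(1)] by (simp add: distrib_left sum.distrib flip: sum_distrib_right)
  then show "phase_transition n \<eta> (\<lambda>t. f t b) r j * phase_transition n \<eta> (\<lambda>t. f t b) j k =
      phase_transition n \<eta> (\<lambda>t. f t b) r k"
    using phase_Ints[OF alternating_Ints, of "\<lambda>A. real_of_int (\<eta> A)" "[r, j, k]"]
    by (simp add: phase_transition_def flip: phase_add) (simp add: phase_add)
next
  fix r j assume "r \<le> n" "j \<le> n"
  show "continuous_on S (\<lambda>b. phase_transition n \<eta> (\<lambda>t. f t b) r j)"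
    unfolding phase_transition_def by (intro continuous_intros weight_continuous) auto
qed (auto simp: phase_transition_def weight_pos weight_nonneg weight_continuous)

text \<open>The real cochain \<open>\<nu>\<close> enters the transition functions only through a conjugation.\<close>

lemma phase_gauge:
  fixes \<theta> \<theta>' \<nu> :: "nat set \<Rightarrow> real"
  assumes "face_closed K" and \<theta>: "\<And>A. \<theta> A = \<theta>' A - coboundary K 1 \<nu> A"
    and b: "b \<in> S" and r: "r \<le> n" "0 < f r b" and j: "j \<le> n" "0 < f j b"
  shows "phase (alternating \<nu> [r, j] + (\<Sum>t = 0..n. f t b * alternating \<theta> [r, j, t])) =
    phase (\<Sum>t = 0..n. f t b * alternating \<nu> [r, t]) *
    phase (\<Sum>t = 0..n. f t b * alternating \<theta>' [r, j, t]) /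
    phase (\<Sum>t = 0..n. f t b * alternating \<nu> [j, t])"
proof -
  \<comment> \<open>As the weights sum to 1, the constant \<nu>_rj can be moved under the sum, where
    the coboundary in \<theta> trades it for \<nu>_rt - \<nu>_jt.\<close>
  have "(\<Sum>t = 0..n. f t b * (alternating \<nu> [r, j] + alternating \<theta> [r, j, t])) =
      (\<Sum>t = 0..n. f t b * (alternating \<nu> [r, t] + alternating \<theta>' [r, j, t] - alternating \<nu> [j, t]))"
  proof (rule weighted_sum_cong[OF b])
    fix t assume "t \<le> n" "0 < f t b"
    then have "{r, j, t} \<in> K"
      using support_face[OF assms(1) b, of "{r, j, t}"] r j by auto
    note alternating_coboundary_1[OF this, of \<nu>]
    moreover have "alternating \<theta> [r, j, t] =
        alternating \<theta>' [r, j, t] - alternating (coboundary K 1 \<nu>) [r, j, t]"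
      by (simp add: alternating_def \<theta> right_diff_distrib)
    ultimately show "alternating \<nu> [r, j] + alternating \<theta> [r, j, t] =
        alternating \<nu> [r, t] + alternating \<theta>' [r, j, t] - alternating \<nu> [j, t]"
      by simp
  qed
  then have "alternating \<nu> [r, j] + (\<Sum>t = 0..n. f t b * alternating \<theta> [r, j, t]) =
      (\<Sum>t = 0..n. f t b * alternating \<nu> [r, t]) + (\<Sum>t = 0..n. f t b * alternating \<theta>' [r, j, t])
      - (\<Sum>t = 0..n. f t b * alternating \<nu> [j, t])"
    using weight_sum[OF b]
    by (simp add: distrib_left right_diff_distrib sum.distrib sum_subtractf flip: sum_distrib_right)
  then show ?thesis
    by (simp only: phase_add phase_diff)
qed

lemma continuous_on_phase_gauge:
  "continuous_on S (\<lambda>b. phase (\<Sum>t = 0..n. f t b * alternating \<nu> [r, t]))"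
  by (intro continuous_intros weight_continuous) auto

lemma homotopic_sign_line_maps:
  assumes K: "face_closed K" and "(\<tau>, \<tau>') \<in> cohomologous K 1"
  shows "homotopic_with (\<lambda>_. True) (top_of_set S) inf_proj_space
    (line_map n f (\<lambda>r j _. sign_transition \<tau> r j)) (line_map n f (\<lambda>r j _. sign_transition \<tau>' r j))"
proof -
  have \<tau>: "\<tau>' \<in> cocycles K 1" and "(\<lambda>A. \<tau> A - \<tau>' A) \<in> coboundaries K 1"
    using assms(2) by (auto simp: cohomologous_def)
  then obtain \<rho> where "(\<lambda>A. \<tau> A - \<tau>' A) = coboundary K 0 \<rho>"
    by (auto simp: coboundaries_def)
  then have \<rho>: "\<tau> A - \<tau>' A = coboundary K 0 \<rho> A" for A
    by metis
  interpret line_data n S f "\<lambda>r j _. sign_transition \<tau>' r j"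
    using line_data_sign[OF K \<tau>] .
  have "homotopic_with (\<lambda>_. True) (top_of_set S) inf_proj_space
    (line_map n f (\<lambda>r j _. sign_transition \<tau>' r j))
    (line_map n f (\<lambda>r j _. bit_sign (\<rho> {r}) * sign_transition \<tau>' r j / bit_sign (\<rho> {j})))"
    by (rule homotopic_conjugate_line_map) (auto simp: bit_sign_nonzero)
  then have "homotopic_with (\<lambda>_. True) (top_of_set S) inf_proj_space
    (line_map n f (\<lambda>r j _. sign_transition \<tau>' r j)) (line_map n f (\<lambda>r j _. sign_transition \<tau> r j))"
  proof (rule homotopic_with_eq)
    fix b assume b: "b \<in> topspace (top_of_set S)"
    show "line_map n f (\<lambda>r j _. sign_transition \<tau> r j) b =
        line_map n f (\<lambda>r j _. bit_sign (\<rho> {r}) * sign_transition \<tau>' r j / bit_sign (\<rho> {j})) b"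
    proof (rule line_map_cong[OF refl])
      fix r j assume "r \<le> n" "j \<le> n" "f r b \<noteq> 0" "0 < f j b"
      then have "{r, j} \<in> K"
        using b weight_nonneg[of b r] by (intro support_face[OF K, of b]) auto
      then show "sign_transition \<tau> r j = bit_sign (\<rho> {r}) * sign_transition \<tau>' r j / bit_sign (\<rho> {j})"
        by (rule sign_transition_gauge[OF \<rho>])
    qed
  qed auto
  then show ?thesis
    by (rule homotopic_with_symD)
qed

text \<open>Serves two purposes: for harmonic \<theta> it eliminates the real choices, and for
  integral \<theta> and \<nu> it compares cohomologous cocycles.\<close>

lemma homotopic_phase_line_map:
  assumes K: "face_closed K" and \<eta>: "\<eta> \<in> cocycles K 2"
    and \<theta>: "\<And>A. \<theta> A = real_of_int (\<eta> A) - coboundary K 1 \<nu> A"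
  shows "homotopic_with (\<lambda>_. True) (top_of_set S) inf_proj_space
    (line_map n f (\<lambda>r j b. phase_transition n \<eta> (\<lambda>t. f t b) r j))
    (line_map n f (\<lambda>r j b. phase (alternating \<nu> [r, j] +
      (\<Sum>t = 0..n. f t b * alternating \<theta> [r, j, t]))))"
proof -
  interpret line_data n S f "\<lambda>r j b. phase_transition n \<eta> (\<lambda>t. f t b) r j"
    using line_data_phase[OF K \<eta>] .
  let ?a = "\<lambda>r b. phase (\<Sum>t = 0..n. f t b * alternating \<nu> [r, t])"
  have "homotopic_with (\<lambda>_. True) (top_of_set S) inf_proj_space
    (line_map n f (\<lambda>r j b. phase_transition n \<eta> (\<lambda>t. f t b) r j))
    (line_map n f (\<lambda>r j b. ?a r b * phase_transition n \<eta> (\<lambda>t. f t b) r j / ?a j b))"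
    by (rule homotopic_conjugate_line_map) (auto simp: continuous_on_phase_gauge)
  then show ?thesis
  proof (rule homotopic_with_eq)
    fix b assume b: "b \<in> topspace (top_of_set S)"
    show "line_map n f (\<lambda>r j b. phase (alternating \<nu> [r, j] +
          (\<Sum>t = 0..n. f t b * alternating \<theta> [r, j, t]))) b =
        line_map n f (\<lambda>r j b. ?a r b * phase_transition n \<eta> (\<lambda>t. f t b) r j / ?a j b) b"
    proof (rule line_map_cong[OF refl])
      fix r j assume "r \<le> n" "j \<le> n" "f r b \<noteq> 0" "0 < f j b"
      then show "phase (alternating \<nu> [r, j] + (\<Sum>t = 0..n. f t b * alternating \<theta> [r, j, t])) =
          ?a r b * phase_transition n \<eta> (\<lambda>t. f t b) r j / ?a j b"
        unfolding phase_transition_def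
        using b weight_nonneg[of b r] by (intro phase_gauge[OF K \<theta>]) auto
    qed
  qed auto
qed

lemma homotopic_phase_line_maps:
  assumes K: "face_closed K" and "(\<eta>, \<eta>') \<in> cohomologous K 2"
  shows "homotopic_with (\<lambda>_. True) (top_of_set S) inf_proj_space
    (line_map n f (\<lambda>r j b. phase_transition n \<eta> (\<lambda>t. f t b) r j))
    (line_map n f (\<lambda>r j b. phase_transition n \<eta>' (\<lambda>t. f t b) r j))"
proof -
  have \<eta>: "\<eta> \<in> cocycles K 2" and "(\<lambda>A. \<eta> A - \<eta>' A) \<in> coboundaries K 2"
    using assms(2) by (auto simp: cohomologous_def)
  then obtain \<rho> where "(\<lambda>A. \<eta> A - \<eta>' A) = coboundary K 1 \<rho>"
    by (auto simp: coboundaries_def numeral_2_eq_2)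
  then have "\<eta>' A = \<eta> A - coboundary K 1 \<rho> A" for A
    by (simp add: fun_eq_iff algebra_simps)
  then have \<rho>: "real_of_int (\<eta>' A) = real_of_int (\<eta> A) - coboundary K 1 (\<lambda>A. real_of_int (\<rho> A)) A" for A
    by (simp only: coboundary_of_int of_int_diff)
  \<comment> \<open>An integral \<nu> drops out of the phase, so the other end of the previous
    homotopy is the map of \<open>\<eta>'\<close>.\<close>
  have "phase (alternating (\<lambda>A. real_of_int (\<rho> A)) [r, j] + x) = phase x" for r j x
    using phase_Ints[OF alternating_Ints, of "\<lambda>A. real_of_int (\<rho> A)" "[r, j]"]
    by (simp add: phase_add)
  then show ?thesis
    using homotopic_phase_line_map[OF K \<eta> \<rho>] by (simp add: phase_transition_def)
qed

end

section \<open>Scale changes in the sparse Cech complex\<close>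

lemma sum_pos_witness:
  fixes w :: "nat \<Rightarrow> real"
  assumes "\<And>r. r \<le> n \<Longrightarrow> 0 \<le> w r" "j \<le> n" "0 < w j"
  shows "0 < (\<Sum>t = 0..n. w t)"
  using assms by (intro sum_pos2[of _ j]) auto

lemma simplicial_weights_normalize:
  assumes cont: "\<And>r. r \<le> n \<Longrightarrow> continuous_on S (w r)"
    and nonneg: "\<And>r b. b \<in> S \<Longrightarrow> r \<le> n \<Longrightarrow> 0 \<le> w r b"
    and pos: "\<And>b. b \<in> S \<Longrightarrow> \<exists>j\<le>n. 0 < w j b"
    and simplex: "\<And>b. b \<in> S \<Longrightarrow> {r. r \<le> n \<and> 0 < w r b} \<in> K"
  shows "simplicial_weights n K S (\<lambda>r b. w r b / (\<Sum>t = 0..n. w t b))"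
proof
  have sum_pos: "0 < (\<Sum>t = 0..n. w t b)" if b: "b \<in> S" for b
  proof -
    obtain j where j: "j \<le> n" "0 < w j b"
      using pos[OF b] by blast
    show ?thesis
      by (rule sum_pos_witness[of n "\<lambda>t. w t b", OF nonneg[OF b] j])
  qed
  show "continuous_on S (\<lambda>b. w r b / (\<Sum>t = 0..n. w t b))" if "r \<le> n" for r
  proof (intro continuous_on_divide continuous_on_sum cont)
    show "\<forall>b\<in>S. (\<Sum>t = 0..n. w t b) \<noteq> 0"
      using sum_pos by fastforce
  qed (use that in auto)
  show "0 \<le> w r b / (\<Sum>t = 0..n. w t b)" if "b \<in> S" "r \<le> n" for r b
    using nonneg[OF that] sum_pos[OF that(1)] by simp
  show "(\<Sum>r = 0..n. w r b / (\<Sum>t = 0..n. w t b)) = 1" if "b \<in> S" for b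
    using sum_pos[OF that] by (simp flip: sum_divide_distrib)
  show "{r. r \<le> n \<and> 0 < w r b / (\<Sum>t = 0..n. w t b)} \<in> K" if "b \<in> S" for b
    using simplex[OF that] sum_pos[OF that] by (simp add: zero_less_divide_iff not_less[symmetric])
qed

lemma simplicial_weights_mono:
  assumes "simplicial_weights n K S f" "S' \<subseteq> S" "K \<subseteq> K'"
  shows "simplicial_weights n K' S' f"
proof -
  interpret simplicial_weights n K S f by fact
  show ?thesis
  proof
    show "continuous_on S' (f r)" if "r \<le> n" for r
      using weight_continuous[OF that] assms(2) by (rule continuous_on_subset)
    show "{r. r \<le> n \<and> 0 < f r b} \<in> K'" if "b \<in> S'" for b
      using support_simplex[of b] that assms(2,3) by blast
  qed (use assms(2) weight_nonneg weight_sum in auto)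
qed

text \<open>Inside the segment the support is the union of the two supports, so this union has to be
  a simplex; at the ends it shrinks to a face.\<close>

lemma simplicial_weights_straight_line:
  assumes f: "simplicial_weights n K S f" and f': "simplicial_weights n K S f'" and K: "face_closed K"
    and simplex: "\<And>b. b \<in> S \<Longrightarrow> {r. r \<le> n \<and> (0 < f r b \<or> 0 < f' r b)} \<in> K"
  shows "simplicial_weights n K ({0..1} \<times> S) (\<lambda>r p. (1 - fst p) * f r (snd p) + fst p * f' r (snd p))"
proof -
  interpret f: simplicial_weights n K S f by fact
  interpret f': simplicial_weights n K S f' by fact
  let ?F = "\<lambda>r p. (1 - fst p) * f r (snd p) + fst p * f' r (snd p)"
  have snd: "continuous_on ({0..1::real} \<times> S) (\<lambda>p. h (snd p))" if "continuous_on S h" for h :: "'a \<Rightarrow> real"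
    using that by (rule continuous_on_compose2) (auto intro: continuous_on_snd)
  have fst: "continuous_on ({0..1::real} \<times> S) fst"
    by (auto intro!: continuous_intros)
  have sum: "(\<Sum>r = 0..n. ?F r p) = 1" if "p \<in> {0..1} \<times> S" for p
    using that f.weight_sum[of "snd p"] f'.weight_sum[of "snd p"]
    by (auto simp: sum.distrib simp flip: sum_distrib_left)
  have nonneg: "0 \<le> ?F r p" if "p \<in> {0..1} \<times> S" "r \<le> n" for r p
    using that f.weight_nonneg[of "snd p" r] f'.weight_nonneg[of "snd p" r]
    by (intro add_nonneg_nonneg mult_nonneg_nonneg) auto
  show ?thesis
  proof
    fix r assume "r \<le> n"
    then show "continuous_on ({0..1} \<times> S) (?F r)"
      by (intro continuous_on_add continuous_on_mult continuous_on_diff continuous_on_const fst snd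
          f.weight_continuous f'.weight_continuous)
  next
    fix p :: "real \<times> 'a" assume p: "p \<in> {0..1} \<times> S"
    let ?A = "{r. r \<le> n \<and> 0 < ?F r p}"
    have "?A \<subseteq> {r. r \<le> n \<and> (0 < f r (snd p) \<or> 0 < f' r (snd p))}"
    proof safe
      fix r assume r: "r \<le> n" "0 < ?F r p" "\<not> 0 < f' r (snd p)"
      then show "0 < f r (snd p)"
        using p f.weight_nonneg[of "snd p" r] f'.weight_nonneg[of "snd p" r]
        by (cases "f r (snd p) = 0") auto
    qed
    moreover have "?A \<noteq> {}"
    proof
      assume "?A = {}"
      then have "(\<Sum>r = 0..n. ?F r p) \<le> 0"
        by (intro sum_nonpos) (auto simp: not_less)
      then show False
        using sum[OF p] by simp
    qed
    ultimately show "?A \<in> K"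
      using simplex[of "snd p"] p K unfolding face_closed_def by (auto simp: mem_Times_iff)
  qed (use sum nonneg in auto)
qed

section \<open>The sparse Cech complex and its partition of unity\<close>

lemma face_closed_sparse_cech: "face_closed (sparse_cech \<sigma> n \<epsilon> \<alpha>)"
  unfolding face_closed_def sparse_cech_def by (auto intro: finite_subset) blast

lemma finite_sparse_cech: "finite (sparse_cech \<sigma> n \<epsilon> \<alpha>)"
  by (rule finite_subset[of _ "Pow {0..n}"]) (auto simp: sparse_cech_def)

lemma sparse_cech_mono:
  assumes "\<alpha> \<le> \<beta>"
  shows "sparse_cech \<sigma> n \<epsilon> \<alpha> \<subseteq> sparse_cech \<sigma> n \<epsilon> \<beta>"
proof -
  have "ball_history \<sigma> \<epsilon> s \<alpha> \<subseteq> ball_history \<sigma> \<epsilon> s \<beta>" for s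
    using assms by (auto simp: ball_history_def)
  then show ?thesis
    unfolding sparse_cech_def by blast
qed

text \<open>The common point of the histories is (b, l). The scale coordinate lets a simplex that
  appears at scale l persist after its balls have shrunk to nothing.\<close>

lemma sparse_cech_simplexI:
  assumes "0 \<le> l" "l \<le> \<beta>" "A \<noteq> {}" "\<And>s. s \<in> A \<Longrightarrow> s \<le> n \<and> b \<in> sparse_ball \<sigma> \<epsilon> s l"
  shows "A \<in> sparse_cech \<sigma> n \<epsilon> \<beta>"
proof -
  have "(b, l) \<in> (\<Inter>s\<in>A. ball_history \<sigma> \<epsilon> s \<beta>)"
    using assms by (auto simp: ball_history_def)
  then show ?thesis
    using assms unfolding sparse_cech_def by fastforce
qed

lemma radius_0: "0 < \<epsilon> \<Longrightarrow> radius \<sigma> \<epsilon> 0 \<alpha> = \<alpha>"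
  by (simp add: radius_def insertion_radius_def)

lemma radius_pos_index:
  assumes "0 < s"
  shows "radius \<sigma> \<epsilon> s \<alpha> =
    (let l = infdist (\<sigma> s) (\<sigma> ` {0..<s}) in
     if \<alpha> < l * ((1 + \<epsilon>) / \<epsilon>) then \<alpha>
     else if \<alpha> \<le> l * ((1 + \<epsilon>)\<^sup>2 / \<epsilon>) then l * ((1 + \<epsilon>) / \<epsilon>) else 0)"
  using assms by (simp add: radius_def insertion_radius_def Let_def)

text \<open>A ball with a point has positive radius, so the scale has not passed the drop, which is
  what activity says. Thus \<open>active\<close> can be replaced by all indices up to n.\<close>

lemma sparse_ball_active:
  assumes "0 < \<epsilon>" "s \<le> n" "b \<in> sparse_ball \<sigma> \<epsilon> s \<alpha>"
  shows "s \<in> active \<sigma> n \<epsilon> \<alpha>"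
proof (cases "s = 0")
  case True
  then show ?thesis by (simp add: active_def insertion_radius_def)
next
  case False
  let ?l = "infdist (\<sigma> s) (\<sigma> ` {0..<s})"
  have "0 < radius \<sigma> \<epsilon> s \<alpha>"
    using assms(3) by (auto simp: sparse_ball_def intro: le_less_trans[OF zero_le_dist])
  moreover have "?l * ((1 + \<epsilon>) / \<epsilon>) \<le> ?l * ((1 + \<epsilon>)\<^sup>2 / \<epsilon>)"
    using assms(1) by (intro mult_left_mono divide_right_mono infdist_nonneg) (auto simp: power2_eq_square)
  ultimately have "\<alpha> \<le> ?l * ((1 + \<epsilon>)\<^sup>2 / \<epsilon>)"
    using False by (auto simp: radius_pos_index Let_def split: if_splits)
  then have "\<epsilon> * \<alpha> / (1 + \<epsilon>)\<^sup>2 \<le> ?l"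
    using assms(1) by (simp add: field_simps)
  then show ?thesis
    using False assms(2) by (simp add: active_def insertion_radius_def)
qed

lemma Union_sparse_cover:
  assumes "0 < \<epsilon>"
  shows "\<Union>(sparse_cover \<sigma> n \<epsilon> \<alpha>) = {b. \<exists>s\<le>n. b \<in> sparse_ball \<sigma> \<epsilon> s \<alpha>}"
  using sparse_ball_active[OF assms, of _ n _ \<sigma> \<alpha>] by (auto simp: sparse_cover_def active_def)

lemma partition_fun_pos_iff:
  assumes "r \<le> n"
  shows "0 < partition_fun \<sigma> n \<epsilon> \<alpha> r b \<longleftrightarrow> b \<in> sparse_ball \<sigma> \<epsilon> r \<alpha>"
proof
  assume "b \<in> sparse_ball \<sigma> \<epsilon> r \<alpha>"
  then have pos: "0 < (max (radius \<sigma> \<epsilon> r \<alpha> - dist b (\<sigma> r)) 0)\<^sup>2"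
    by (auto simp: sparse_ball_def max_def)
  then have "0 < (\<Sum>t = 0..n. (max (radius \<sigma> \<epsilon> t \<alpha> - dist b (\<sigma> t)) 0)\<^sup>2)"
    by (intro sum_pos_witness[OF _ assms]) auto
  then show "0 < partition_fun \<sigma> n \<epsilon> \<alpha> r b"
    using pos by (simp add: partition_fun_def)
next
  assume "0 < partition_fun \<sigma> n \<epsilon> \<alpha> r b"
  then have "max (radius \<sigma> \<epsilon> r \<alpha> - dist b (\<sigma> r)) 0 \<noteq> 0"
    by (auto simp: partition_fun_def)
  then show "b \<in> sparse_ball \<sigma> \<epsilon> r \<alpha>"
    by (auto simp: sparse_ball_def max_def split: if_splits)
qed

lemma simplicial_weights_partition_fun:
  assumes "0 < \<epsilon>" "0 \<le> \<alpha>"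
  shows "simplicial_weights n (sparse_cech \<sigma> n \<epsilon> \<alpha>) (\<Union>(sparse_cover \<sigma> n \<epsilon> \<alpha>)) (partition_fun \<sigma> n \<epsilon> \<alpha>)"
  unfolding partition_fun_def[abs_def]
proof (rule simplicial_weights_normalize)
  let ?w = "\<lambda>r b. (max (radius \<sigma> \<epsilon> r \<alpha> - dist b (\<sigma> r)) 0)\<^sup>2"
  have w: "0 < ?w r b \<longleftrightarrow> b \<in> sparse_ball \<sigma> \<epsilon> r \<alpha>" for r b
    by (auto simp: sparse_ball_def max_def)
  fix b assume b: "b \<in> \<Union>(sparse_cover \<sigma> n \<epsilon> \<alpha>)"
  show pos: "\<exists>j\<le>n. 0 < ?w j b"
    using b unfolding w Union_sparse_cover[OF assms(1)] by blast
  show "{r. r \<le> n \<and> 0 < ?w r b} \<in> sparse_cech \<sigma> n \<epsilon> \<alpha>"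
    using pos unfolding w by (intro sparse_cech_simplexI[of \<alpha> \<alpha> _ n b]) (use assms in auto)
qed (auto intro!: continuous_intros)

section \<open>Deformation of the scale through cutoff weights\<close>

text \<open>The ball radius jumps to \<open>0\<close> at the scale \<open>\<lambda>\<^sub>s (1 + \<epsilon>)\<^sup>2 / \<epsilon>\<close>. The
  cutoff factor makes the weight vanish continuously there; it is harmless because the balls of
  larger insertion radius already cover the dying ball.\<close>

definition cutoff_weight :: "(nat \<Rightarrow> 'a::metric_space) \<Rightarrow> real \<Rightarrow> nat \<Rightarrow> real \<Rightarrow> 'a \<Rightarrow> real" where
  "cutoff_weight \<sigma> \<epsilon> s l b =
     (if s = 0 then max 0 (l - dist b (\<sigma> 0))
      else max 0 (infdist (\<sigma> s) (\<sigma> ` {0..<s}) * ((1 + \<epsilon>)\<^sup>2 / \<epsilon>) - l) *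
        max 0 (min l (infdist (\<sigma> s) (\<sigma> ` {0..<s}) * ((1 + \<epsilon>) / \<epsilon>)) - dist b (\<sigma> s)))"

lemma cutoff_weight_nonneg: "0 \<le> cutoff_weight \<sigma> \<epsilon> s l b"
  by (simp add: cutoff_weight_def)

text \<open>A positive cutoff factor puts l before the drop, and there the minimum in the second
  factor is exactly the radius. Index 0 has infinite insertion radius and never drops, hence its
  separate case.\<close>

lemma cutoff_weight_pos_ball:
  assumes "0 < \<epsilon>" "0 < cutoff_weight \<sigma> \<epsilon> s l b"
  shows "b \<in> sparse_ball \<sigma> \<epsilon> s l"
proof (cases "s = 0")
  case True
  then show ?thesis
    using assms by (auto simp: cutoff_weight_def sparse_ball_def radius_0 less_max_iff_disj)
next
  case False
  then show ?thesis
    using assms by (auto simp: cutoff_weight_def sparse_ball_def radius_pos_index Let_def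
        zero_less_mult_iff less_max_iff_disj)
qed

lemma continuous_on_cutoff_weight:
  assumes "continuous_on T h" "continuous_on T k"
  shows "continuous_on T (\<lambda>p. cutoff_weight \<sigma> \<epsilon> s (h p) (k p))"
  unfolding cutoff_weight_def using assms by (cases "s = 0") (auto intro!: continuous_intros)

text \<open>Take for \<open>t\<close> a nearest point among those preceding the first point with insertion
  radius below \<open>c\<close>.\<close>

lemma greedy_net:
  assumes greedy: "greedy_permutation n X \<sigma>" and "s \<le> n" "0 < c"
  obtains t where "t \<le> n" "t = 0 \<or> c \<le> infdist (\<sigma> t) (\<sigma> ` {0..<t})" "dist (\<sigma> s) (\<sigma> t) < c"
proof (cases "s = 0 \<or> c \<le> infdist (\<sigma> s) (\<sigma> ` {0..<s})")
  case True
  then show ?thesis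
    using that[of s] assms by simp
next
  case False
  let ?P = "\<lambda>k. 0 < k \<and> infdist (\<sigma> k) (\<sigma> ` {0..<k}) < c"
  define k where "k = (LEAST k. ?P k)"
  have k: "?P k" "k \<le> s" "\<And>t. t < k \<Longrightarrow> \<not> ?P t"
    unfolding k_def using False by (auto intro!: LeastI[of ?P s] Least_le[of ?P s] dest: not_less_Least)
  then obtain k' where k': "k = Suc k'"
    by (cases k) auto
  have "\<sigma> s \<in> X" "k' < n"
    using greedy assms(2) k(2) k' by (auto simp: greedy_permutation_def bij_betw_def)
  \<comment> \<open>\<open>\<sigma> k\<close> was chosen as a point farthest from its predecessors,
    so its insertion radius bounds the distance of \<open>\<sigma> s\<close> to them.\<close>
  then have "infdist (\<sigma> s) (\<sigma> ` {0..k'}) \<le> infdist (\<sigma> (Suc k')) (\<sigma> ` {0..k'})"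
    using greedy unfolding greedy_permutation_def by blast
  then have "infdist (\<sigma> s) (\<sigma> ` {0..<k}) \<le> infdist (\<sigma> k) (\<sigma> ` {0..<k})"
    using k' by (simp only: atLeastLessThanSuc_atLeastAtMost)
  then have "infdist (\<sigma> s) (\<sigma> ` {0..<k}) < c"
    using k by simp
  then have "\<exists>t\<in>{0..<k}. dist (\<sigma> s) (\<sigma> t) < c"
    using k(1) by (subst (asm) infdist_notempty) (auto simp: cInf_less_iff image_image)
  then obtain t where t: "t < k" "dist (\<sigma> s) (\<sigma> t) < c"
    by auto
  moreover have "t = 0 \<or> c \<le> infdist (\<sigma> t) (\<sigma> ` {0..<t})"
    using k(3)[OF t(1)] by auto
  ultimately show ?thesis
    using that[of t] k(2) assms(2) by simp
qed

text \<open>Index s never drops, is still alive at scale l, or has dropped. In the last case b is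
  within l / (1 + \<epsilon>) of \<open>\<sigma> s\<close>, and some net point is within \<epsilon>
  l / (1 + \<epsilon>) of \<open>\<sigma> s\<close>; the two bounds add up to l, the full radius of
  the net point's ball.\<close>

lemma cutoff_weight_pos_exists:
  assumes greedy: "greedy_permutation n X \<sigma>" and \<epsilon>: "0 < \<epsilon>" and \<alpha>: "0 \<le> \<alpha>" "\<alpha> \<le> l"
    and s: "s \<le> n" and b: "b \<in> sparse_ball \<sigma> \<epsilon> s \<alpha>"
  shows "\<exists>t\<le>n. 0 < cutoff_weight \<sigma> \<epsilon> t l b"
proof -
  let ?l = "\<lambda>s. infdist (\<sigma> s) (\<sigma> ` {0..<s})"
  have dist: "dist b (\<sigma> s) < radius \<sigma> \<epsilon> s \<alpha>"
    using b by (simp add: sparse_ball_def)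
  consider "s = 0" | "0 < s" "l < ?l s * ((1 + \<epsilon>)\<^sup>2 / \<epsilon>)" | "0 < s" "?l s * ((1 + \<epsilon>)\<^sup>2 / \<epsilon>) \<le> l"
    by linarith
  then show ?thesis
  proof cases
    case 1
    then show ?thesis
      using dist \<alpha> \<epsilon> by (intro exI[of _ 0]) (auto simp: radius_0 cutoff_weight_def)
  next
    case 2
    have "0 \<le> dist b (\<sigma> s)"
      by simp
    then have "dist b (\<sigma> s) < min l (?l s * ((1 + \<epsilon>) / \<epsilon>))"
      using dist 2 \<alpha> by (auto simp: radius_pos_index Let_def split: if_splits)
    then show ?thesis
      using 2 s by (intro exI[of _ s]) (auto simp: cutoff_weight_def zero_less_mult_iff less_max_iff_disj)
  next
    case 3
    have "0 < radius \<sigma> \<epsilon> s \<alpha>"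
      using dist by (rule le_less_trans[OF zero_le_dist])
    \<comment> \<open>The radius at \<alpha> is positive although l is past the drop, so it is at
      most the plateau value; one more factor 1 + \<epsilon> leads from the plateau to the
      drop.\<close>
    then have r: "radius \<sigma> \<epsilon> s \<alpha> \<le> ?l s * ((1 + \<epsilon>) / \<epsilon>)"
      using 3 by (auto simp: radius_pos_index Let_def split: if_splits)
    have e: "(?l s * ((1 + \<epsilon>) / \<epsilon>)) * (1 + \<epsilon>) = ?l s * ((1 + \<epsilon>)\<^sup>2 / \<epsilon>)"
      by (simp add: power2_eq_square)
    have r': "radius \<sigma> \<epsilon> s \<alpha> * (1 + \<epsilon>) \<le> l"
      using mult_right_mono[OF r, of "1 + \<epsilon>"] 3 \<epsilon> e by linarith
    have l: "0 < l"
      using r' \<open>0 < radius \<sigma> \<epsilon> s \<alpha>\<close> \<epsilon> by (smt (verit) mult_pos_pos)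
    \<comment> \<open>An insertion radius of at least \<open>c\<close> means that at scale l the
      radius is still the full l.\<close>
    define c where "c = \<epsilon> * l / (1 + \<epsilon>)"
    have c: "0 < c"
      using l \<epsilon> by (simp add: c_def)
    then obtain t where t: "t \<le> n" "t = 0 \<or> c \<le> ?l t" "dist (\<sigma> s) (\<sigma> t) < c"
      using greedy_net[OF greedy s] by blast
    have "dist b (\<sigma> t) \<le> dist b (\<sigma> s) + dist (\<sigma> s) (\<sigma> t)"
      by (rule dist_triangle)
    also have "\<dots> < l / (1 + \<epsilon>) + c"
      using dist r' t(3) \<epsilon> by (simp add: pos_le_divide_eq[symmetric])
    also have "\<dots> = l"
      using \<epsilon> by (simp add: c_def divide_eq_eq algebra_simps flip: add_divide_distrib)
    finally have d: "dist b (\<sigma> t) < l" .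
    show ?thesis
    proof (cases "t = 0")
      case True
      then show ?thesis
        using d by (intro exI[of _ 0]) (simp add: cutoff_weight_def)
    next
      case False
      then have "l \<le> ?l t * ((1 + \<epsilon>) / \<epsilon>)"
        using t(2) \<epsilon> by (simp add: c_def field_simps)
      \<comment> \<open>Strictness matters: l must lie strictly below the drop of t for the cutoff
        factor to be positive.\<close>
      moreover have "?l t * ((1 + \<epsilon>) / \<epsilon>) * 1 < ?l t * ((1 + \<epsilon>) / \<epsilon>) * (1 + \<epsilon>)"
        using calculation l \<epsilon> by (intro mult_strict_left_mono) auto
      ultimately have "l < ?l t * ((1 + \<epsilon>)\<^sup>2 / \<epsilon>)"
        by (simp add: power2_eq_square)
      then show ?thesis
        using \<open>l \<le> ?l t * ((1 + \<epsilon>) / \<epsilon>)\<close> d False t(1)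
        by (intro exI[of _ t]) (auto simp: cutoff_weight_def zero_less_mult_iff less_max_iff_disj)
    qed
  qed
qed

text \<open>Single balls can disappear as the scale grows, but a point once covered keeps some
  positive cutoff weight at every later scale.\<close>

lemma Union_sparse_cover_mono:
  assumes "greedy_permutation n X \<sigma>" "0 < \<epsilon>" "0 \<le> \<alpha>" "\<alpha> \<le> \<beta>"
  shows "\<Union>(sparse_cover \<sigma> n \<epsilon> \<alpha>) \<subseteq> \<Union>(sparse_cover \<sigma> n \<epsilon> \<beta>)"
  using cutoff_weight_pos_exists[OF assms] cutoff_weight_pos_ball[OF assms(2)]
  unfolding Union_sparse_cover[OF assms(2)] by blast

text \<open>Taking \<open>g\<close> as a functional of the weights lets one argument serve the
  constant signs and the weight-dependent phases. The hypothesis ranges over all weights on subsets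
  of the cylinder's ambient space, so it applies to each piece of the path: to the cutoff weights at
  \<alpha>, along the scales, and back from the cutoff weights at \<beta>.\<close>

lemma homotopic_partition_line_maps:
  fixes \<sigma> :: "nat \<Rightarrow> 'a::metric_space" and g :: "(nat \<Rightarrow> real) \<Rightarrow> nat \<Rightarrow> nat \<Rightarrow> 'k::real_normed_field"
  assumes greedy: "greedy_permutation n X \<sigma>" and \<epsilon>: "0 < \<epsilon>" and \<alpha>: "0 \<le> \<alpha>" "\<alpha> \<le> \<beta>"
    and g: "\<And>T F. simplicial_weights n (sparse_cech \<sigma> n \<epsilon> \<beta>) T F \<Longrightarrow>
      line_data n (T :: (real \<times> 'a) set) F (\<lambda>r j p. g (\<lambda>t. F t p) r j)"
  shows "homotopic_with (\<lambda>_. True) (cover_space \<sigma> n \<epsilon> \<alpha>) inf_proj_space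
    (line_map n (partition_fun \<sigma> n \<epsilon> \<alpha>) (\<lambda>r j b. g (\<lambda>t. partition_fun \<sigma> n \<epsilon> \<alpha> t b) r j))
    (line_map n (partition_fun \<sigma> n \<epsilon> \<beta>) (\<lambda>r j b. g (\<lambda>t. partition_fun \<sigma> n \<epsilon> \<beta> t b) r j))"
proof -
  let ?S = "\<Union>(sparse_cover \<sigma> n \<epsilon> \<alpha>)" and ?K = "sparse_cech \<sigma> n \<epsilon> \<beta>"
  define M where "M f = line_map n f (\<lambda>r j b. g (\<lambda>t. f t b) r j)" for f :: "nat \<Rightarrow> 'a \<Rightarrow> real"
  define W where "W l r b = cutoff_weight \<sigma> \<epsilon> r l b / (\<Sum>t = 0..n. cutoff_weight \<sigma> \<epsilon> t l b)" for l r b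
  have path: "homotopic_with (\<lambda>_. True) (top_of_set ?S) inf_proj_space
      (M (\<lambda>r b. F r (0, b))) (M (\<lambda>r b. F r (1, b)))"
    if "simplicial_weights n ?K ({0..1} \<times> ?S) F" for F :: "nat \<Rightarrow> real \<times> 'a \<Rightarrow> real"
    unfolding M_def using homotopic_line_maps_ends[OF g[OF that]] by simp
  have pos: "\<exists>t\<le>n. 0 < cutoff_weight \<sigma> \<epsilon> t l b" if "\<alpha> \<le> l" "b \<in> ?S" for l b
    using that cutoff_weight_pos_exists[OF greedy \<epsilon> \<alpha>(1) that(1)]
    unfolding Union_sparse_cover[OF \<epsilon>] by blast
  have simplex: "A \<in> ?K"
    if "\<alpha> \<le> l" "l \<le> \<beta>" "A \<noteq> {}" "\<And>r. r \<in> A \<Longrightarrow> r \<le> n \<and> b \<in> sparse_ball \<sigma> \<epsilon> r l" for A l b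
    using that \<alpha> by (intro sparse_cech_simplexI[of l \<beta> A n b]) auto
  have W: "simplicial_weights n ?K ?S (W l)" if "\<alpha> \<le> l" "l \<le> \<beta>" for l
    unfolding W_def[abs_def]
  proof (rule simplicial_weights_normalize)
    fix b assume "b \<in> ?S"
    then show "\<exists>j\<le>n. 0 < cutoff_weight \<sigma> \<epsilon> j l b"
      by (rule pos[OF that(1)])
    then show "{r. r \<le> n \<and> 0 < cutoff_weight \<sigma> \<epsilon> r l b} \<in> ?K"
      using cutoff_weight_pos_ball[OF \<epsilon>] by (intro simplex[OF that, of _ b]) auto
  qed (auto intro!: continuous_on_cutoff_weight continuous_intros cutoff_weight_nonneg)
  have partition: "simplicial_weights n ?K ?S (partition_fun \<sigma> n \<epsilon> l)" if "\<alpha> \<le> l" "l \<le> \<beta>" for l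
    using that \<alpha> Union_sparse_cover_mono[OF greedy \<epsilon> \<alpha>(1) that(1)] sparse_cech_mono[OF that(2), of \<sigma> n \<epsilon>]
    by (intro simplicial_weights_mono[OF simplicial_weights_partition_fun[OF \<epsilon>]]) auto
  have W_pos: "b \<in> sparse_ball \<sigma> \<epsilon> r l" if "0 < W l r b" for l r b
  proof -
    have "0 < cutoff_weight \<sigma> \<epsilon> r l b"
      using that cutoff_weight_nonneg[of \<sigma> \<epsilon> r l b] by (cases "cutoff_weight \<sigma> \<epsilon> r l b = 0") (auto simp: W_def)
    then show ?thesis
      by (rule cutoff_weight_pos_ball[OF \<epsilon>])
  qed
  \<comment> \<open>At a fixed scale l both supports consist of balls containing b, so (b, l) makes
    their union a simplex and a straight line is allowed.\<close>
  have ends: "homotopic_with (\<lambda>_. True) (top_of_set ?S) inf_proj_space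
      (M (partition_fun \<sigma> n \<epsilon> l)) (M (W l))" if l: "\<alpha> \<le> l" "l \<le> \<beta>" for l
  proof -
    have "simplicial_weights n ?K ({0..1} \<times> ?S)
        (\<lambda>r p. (1 - fst p) * partition_fun \<sigma> n \<epsilon> l r (snd p) + fst p * W l r (snd p))"
    proof (rule simplicial_weights_straight_line[OF partition[OF l] W[OF l] face_closed_sparse_cech])
      fix b assume b: "b \<in> ?S"
      obtain j where "j \<le> n" "0 < partition_fun \<sigma> n \<epsilon> l j b"
        using simplicial_weights.weight_pos[OF partition[OF l] b] by blast
      then show "{r. r \<le> n \<and> (0 < partition_fun \<sigma> n \<epsilon> l r b \<or> 0 < W l r b)} \<in> ?K"
        using W_pos by (intro simplex[OF l, of _ b]) (auto simp: partition_fun_pos_iff)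
    qed
    from path[OF this] show ?thesis
      by simp
  qed
  have "simplicial_weights n ?K ({0..1} \<times> ?S) (\<lambda>r p. W ((1 - fst p) * \<alpha> + fst p * \<beta>) r (snd p))"
    unfolding W_def
  proof (rule simplicial_weights_normalize)
    fix p :: "real \<times> 'a" assume p: "p \<in> {0..1} \<times> ?S"
    let ?l = "(1 - fst p) * \<alpha> + fst p * \<beta>"
    have u: "0 \<le> fst p" "fst p \<le> 1" "snd p \<in> ?S"
      using p by (auto simp: mem_Times_iff)
    have "0 \<le> fst p * (\<beta> - \<alpha>)" "0 \<le> (1 - fst p) * (\<beta> - \<alpha>)"
      using u \<alpha> by auto
    then have l: "\<alpha> \<le> ?l" "?l \<le> \<beta>"
      by (auto simp: algebra_simps)
    show pos': "\<exists>j\<le>n. 0 < cutoff_weight \<sigma> \<epsilon> j ?l (snd p)"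
      by (rule pos[OF l(1) u(3)])
    show "{r. r \<le> n \<and> 0 < cutoff_weight \<sigma> \<epsilon> r ?l (snd p)} \<in> ?K"
      using pos' cutoff_weight_pos_ball[OF \<epsilon>] by (intro simplex[OF l, of _ "snd p"]) auto
  qed (auto intro!: continuous_on_cutoff_weight continuous_intros cutoff_weight_nonneg)
  from path[OF this] have "homotopic_with (\<lambda>_. True) (top_of_set ?S) inf_proj_space (M (W \<alpha>)) (M (W \<beta>))"
    by simp
  with ends[OF order_refl \<alpha>(2)] homotopic_with_symD[OF ends[OF \<alpha>(2) order_refl]]
  have "homotopic_with (\<lambda>_. True) (top_of_set ?S) inf_proj_space
      (M (partition_fun \<sigma> n \<epsilon> \<alpha>)) (M (partition_fun \<sigma> n \<epsilon> \<beta>))"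
    by (blast intro: homotopic_with_trans)
  then show ?thesis
    by (simp add: M_def)
qed

section \<open>Classes of the characteristic maps\<close>

text \<open>The active balls containing b are exactly the indices of positive weight, so both
  descriptions range over the same charts.\<close>

lemma w1_map_eq_line_map:
  assumes "0 < \<epsilon>"
  shows "w1_map \<sigma> n \<epsilon> \<alpha> \<tau> =
    line_map n (partition_fun \<sigma> n \<epsilon> \<alpha>) (\<lambda>r j _. sign_transition \<tau> r j)"
proof
  fix b
  have index: "j \<in> active \<sigma> n \<epsilon> \<alpha> \<and> b \<in> sparse_ball \<sigma> \<epsilon> j \<alpha> \<longleftrightarrow>
      j \<le> n \<and> 0 < partition_fun \<sigma> n \<epsilon> \<alpha> j b" for j
    using sparse_ball_active[OF assms] by (auto simp: partition_fun_pos_iff active_def)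
  have lift: "line_lift n (partition_fun \<sigma> n \<epsilon> \<alpha>) (\<lambda>r j _. sign_transition \<tau> r j) j b =
      (\<lambda>r. if r \<le> n then (if r = j \<or> \<tau> {r, j} = 0 then 1 else - 1) *
        sqrt (partition_fun \<sigma> n \<epsilon> \<alpha> r b) else 0)" for j
    by (auto simp: line_lift_def sign_transition_def bit_sign_def)
  show "w1_map \<sigma> n \<epsilon> \<alpha> \<tau> b =
      line_map n (partition_fun \<sigma> n \<epsilon> \<alpha>) (\<lambda>r j _. sign_transition \<tau> r j) b"
    unfolding w1_map_def line_map_def lift Ball_def
    by (rule arg_cong[of _ _ The], rule ext) (use index in blast)
qed

lemma c1_map_eq_line_map:
  assumes "0 < \<epsilon>"
  shows "c1_map \<sigma> n \<epsilon> \<alpha> \<theta> \<nu> =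
    line_map n (partition_fun \<sigma> n \<epsilon> \<alpha>) (\<lambda>r j b. phase (alternating \<nu> [r, j] +
      (\<Sum>t = 0..n. partition_fun \<sigma> n \<epsilon> \<alpha> t b * alternating \<theta> [r, j, t])))"
proof
  fix b
  have index: "j \<in> active \<sigma> n \<epsilon> \<alpha> \<and> b \<in> sparse_ball \<sigma> \<epsilon> j \<alpha> \<longleftrightarrow>
      j \<le> n \<and> 0 < partition_fun \<sigma> n \<epsilon> \<alpha> j b" for j
    using sparse_ball_active[OF assms] by (auto simp: partition_fun_pos_iff active_def)
  show "c1_map \<sigma> n \<epsilon> \<alpha> \<theta> \<nu> b =
      line_map n (partition_fun \<sigma> n \<epsilon> \<alpha>) (\<lambda>r j b. phase (alternating \<nu> [r, j] +
        (\<Sum>t = 0..n. partition_fun \<sigma> n \<epsilon> \<alpha> t b * alternating \<theta> [r, j, t]))) b"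
    unfolding c1_map_def line_map_def line_lift_def phase_def Ball_def
    by (rule arg_cong[of _ _ The], rule ext) (use index in blast)
qed

section \<open>Homotopy classes and the formal part of the squares\<close>

lemma equiv_homotopy_rel: "equiv {f. continuous_map X Y f} (homotopy_rel X Y)"
proof (rule equivI)
  show "homotopy_rel X Y \<subseteq> {f. continuous_map X Y f} \<times> {f. continuous_map X Y f}"
    by (auto simp: homotopy_rel_def dest: homotopic_with_imp_continuous_maps)
  show "refl_on {f. continuous_map X Y f} (homotopy_rel X Y)"
    by (auto simp: refl_on_def homotopy_rel_def)
  show "sym (homotopy_rel X Y)"
    by (auto simp: sym_def homotopy_rel_def intro: homotopic_with_symD)
  show "trans (homotopy_rel X Y)"
    by (auto simp: trans_def homotopy_rel_def intro: homotopic_with_trans)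
qed

lemma homotopy_rel_Image_eq:
  "homotopic_with (\<lambda>_. True) X Y f g \<Longrightarrow> homotopy_rel X Y `` {f} = homotopy_rel X Y `` {g}"
  by (rule equiv_class_eq[OF equiv_homotopy_rel]) (simp add: homotopy_rel_def)

lemma homotopy_class_in:
  "continuous_map X Y f \<Longrightarrow> homotopy_rel X Y `` {f} \<in> homotopy_classes X Y"
  by (simp add: homotopy_classes_def quotientI)

lemma homotopic_with_restrict:
  assumes "homotopic_with (\<lambda>_. True) (top_of_set S) Y f g" "S' \<subseteq> S"
  shows "homotopic_with (\<lambda>_. True) (top_of_set S') Y f g"
proof -
  have "continuous_map (top_of_set S') (top_of_set S) id"
    using assms(2) by auto
  from homotopic_with_compose_continuous_map_right[OF assms(1) this] show ?thesis
    by simp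
qed

lemma restrict_homotopy_class_eq:
  assumes "continuous_map (top_of_set S) Y f" "S' \<subseteq> S"
  shows "restrict_homotopy_class (top_of_set S') Y (homotopy_rel (top_of_set S) Y `` {f}) =
    homotopy_rel (top_of_set S') Y `` {f}"
proof -
  have "restrict_homotopy_class (top_of_set S') Y (homotopy_rel (top_of_set S) Y `` {f}) =
      (\<Union>g\<in>homotopy_rel (top_of_set S) Y `` {f}. homotopy_rel (top_of_set S') Y `` {f})"
    unfolding restrict_homotopy_class_def
  proof (rule SUP_cong[OF refl])
    fix g assume "g \<in> homotopy_rel (top_of_set S) Y `` {f}"
    then show "homotopy_rel (top_of_set S') Y `` {g} = homotopy_rel (top_of_set S') Y `` {f}"
      using homotopic_with_restrict[OF _ assms(2)]
      by (intro homotopy_rel_Image_eq[symmetric]) (auto simp: homotopy_rel_def)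
  qed
  moreover have "f \<in> homotopy_rel (top_of_set S) Y `` {f}"
    using assms(1) by (simp add: homotopy_rel_def)
  ultimately show ?thesis
    by auto
qed

lemma restrict_homotopy_class_in:
  assumes "S' \<subseteq> S" "c \<in> homotopy_classes (top_of_set S) Y"
  shows "restrict_homotopy_class (top_of_set S') Y c \<in> homotopy_classes (top_of_set S') Y"
proof -
  obtain f where f: "continuous_map (top_of_set S) Y f" "c = homotopy_rel (top_of_set S) Y `` {f}"
    using assms(2) unfolding homotopy_classes_def by (auto elim: quotientE)
  moreover have "continuous_map (top_of_set S') Y f"
    using continuous_map_from_subtopology_mono[OF f(1) assms(1)] .
  ultimately show ?thesis
    using restrict_homotopy_class_eq[OF f(1) assms(1)] by (simp add: homotopy_class_in)
qed

text \<open>Separates the algebra of classes from the geometry, which enters through the homotopy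
  \<open>restrict\<close>. The maps \<open>m\<close> and \<open>m'\<close> may be any convenient
  representatives of the classes.\<close>

lemma commutative_squareI:
  fixes K :: "nat set set" and k :: nat
    and c :: "(nat set \<Rightarrow> 'g::comm_ring_1) set \<Rightarrow> ('b::topological_space \<Rightarrow> 'y) set"
  assumes L: "L \<subseteq> K" "face_closed L" and S: "S' \<subseteq> S"
    and c: "\<And>\<phi>. \<phi> \<in> cocycles L k \<Longrightarrow> c (cohomologous L k `` {\<phi>}) = homotopy_rel (top_of_set S') Y `` {m \<phi>}"
    and cont: "\<And>\<phi>. \<phi> \<in> cocycles L k \<Longrightarrow> continuous_map (top_of_set S') Y (m \<phi>)"
    and c': "\<And>\<phi>. \<phi> \<in> cocycles K k \<Longrightarrow> c' (cohomologous K k `` {\<phi>}) = homotopy_rel (top_of_set S) Y `` {m' \<phi>}"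
    and cont': "\<And>\<phi>. \<phi> \<in> cocycles K k \<Longrightarrow> continuous_map (top_of_set S) Y (m' \<phi>)"
    and restrict: "\<And>\<phi>. \<phi> \<in> cocycles K k \<Longrightarrow> homotopic_with (\<lambda>_. True) (top_of_set S') Y
      (m (\<lambda>A. if A \<in> L then \<phi> A else 0)) (m' \<phi>)"
  shows "commutative_square (cohomology L k) (homotopy_classes (top_of_set S') Y)
    (cohomology K k) (homotopy_classes (top_of_set S) Y) c c'
    (restrict_cohomology L k) (restrict_homotopy_class (top_of_set S') Y)"
  unfolding commutative_square_def
proof (intro conjI ballI Pi_I)
  show "c x \<in> homotopy_classes (top_of_set S') Y" if x: "x \<in> cohomology L k" for x
  proof -
    obtain \<phi> where "\<phi> \<in> cocycles L k" "x = cohomologous L k `` {\<phi>}"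
      using x unfolding cohomology_def by (rule quotientE)
    then show ?thesis
      using homotopy_class_in[OF cont] c by simp
  qed
  show "c' x \<in> homotopy_classes (top_of_set S) Y" if x: "x \<in> cohomology K k" for x
  proof -
    obtain \<phi> where "\<phi> \<in> cocycles K k" "x = cohomologous K k `` {\<phi>}"
      using x unfolding cohomology_def by (rule quotientE)
    then show ?thesis
      using homotopy_class_in[OF cont'] c' by simp
  qed
  show "restrict_cohomology L k x \<in> cohomology L k" if "x \<in> cohomology K k" for x :: "(nat set \<Rightarrow> 'g) set"
    using restrict_cohomology_in[OF L that] .
  show "restrict_homotopy_class (top_of_set S') Y x \<in> homotopy_classes (top_of_set S') Y"
    if "x \<in> homotopy_classes (top_of_set S) Y" for x
    using restrict_homotopy_class_in[OF S that] .
  fix x :: "(nat set \<Rightarrow> 'g) set" assume "x \<in> cohomology K k"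
  then obtain \<phi> where \<phi>: "\<phi> \<in> cocycles K k" and x: "x = cohomologous K k `` {\<phi>}"
    unfolding cohomology_def by (rule quotientE)
  show "c (restrict_cohomology L k x) = restrict_homotopy_class (top_of_set S') Y (c' x)"
    unfolding x restrict_cohomology_class[OF L \<phi>] c[OF restrict_cocycles[OF L \<phi>]] c'[OF \<phi>]
      restrict_homotopy_class_eq[OF cont'[OF \<phi>] S]
    by (rule homotopy_rel_Image_eq[OF restrict[OF \<phi>]])
qed

section \<open>The squares for w_1 and c_1\<close>

text \<open>The maps \<^const>\<open>c1_map\<close> for all choices of \<open>\<theta>\<close> and \<open>\<nu>\<close>
  are homotopic to this one, in which no real cochains are chosen.\<close>

definition bundle_map ::
    "(nat \<Rightarrow> 'a::metric_space) \<Rightarrow> nat \<Rightarrow> real \<Rightarrow> real \<Rightarrow> (nat set \<Rightarrow> int) \<Rightarrow> 'a \<Rightarrow> (nat \<Rightarrow> complex) set"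
  where "bundle_map \<sigma> n \<epsilon> \<alpha> \<eta> = line_map n (partition_fun \<sigma> n \<epsilon> \<alpha>)
    (\<lambda>r j b. phase_transition n \<eta> (\<lambda>t. partition_fun \<sigma> n \<epsilon> \<alpha> t b) r j)"

lemma continuous_w1_map:
  assumes "0 < \<epsilon>" "0 \<le> \<alpha>" "\<tau> \<in> cocycles (sparse_cech \<sigma> n \<epsilon> \<alpha>) 1"
  shows "continuous_map (cover_space \<sigma> n \<epsilon> \<alpha>) RP_inf (w1_map \<sigma> n \<epsilon> \<alpha> \<tau>)"
  unfolding w1_map_eq_line_map[OF assms(1)]
  using simplicial_weights.line_data_sign[OF simplicial_weights_partition_fun[OF assms(1,2)]
      face_closed_sparse_cech assms(3)]
  by (rule line_data.continuous_line_map)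

lemma continuous_bundle_map:
  assumes "0 < \<epsilon>" "0 \<le> \<alpha>" "\<eta> \<in> cocycles (sparse_cech \<sigma> n \<epsilon> \<alpha>) 2"
  shows "continuous_map (cover_space \<sigma> n \<epsilon> \<alpha>) CP_inf (bundle_map \<sigma> n \<epsilon> \<alpha> \<eta>)"
  unfolding bundle_map_def
  using simplicial_weights.line_data_phase[OF simplicial_weights_partition_fun[OF assms(1,2)]
      face_closed_sparse_cech assms(3)]
  by (rule line_data.continuous_line_map)

lemma w1_class_eq:
  assumes "0 < \<epsilon>" "0 \<le> \<alpha>" "\<tau> \<in> cocycles (sparse_cech \<sigma> n \<epsilon> \<alpha>) 1"
  shows "w1_class \<sigma> n \<epsilon> \<alpha> (cohomologous (sparse_cech \<sigma> n \<epsilon> \<alpha>) 1 `` {\<tau>}) =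
    homotopy_rel (cover_space \<sigma> n \<epsilon> \<alpha>) RP_inf `` {w1_map \<sigma> n \<epsilon> \<alpha> \<tau>}"
proof -
  let ?K = "sparse_cech \<sigma> n \<epsilon> \<alpha>"
  have "w1_class \<sigma> n \<epsilon> \<alpha> (cohomologous ?K 1 `` {\<tau>}) =
      (\<Union>\<tau>'\<in>cohomologous ?K 1 `` {\<tau>}. homotopy_rel (cover_space \<sigma> n \<epsilon> \<alpha>) RP_inf `` {w1_map \<sigma> n \<epsilon> \<alpha> \<tau>})"
    unfolding w1_class_def
  proof (rule SUP_cong[OF refl])
    fix \<tau>' assume "\<tau>' \<in> cohomologous ?K 1 `` {\<tau>}"
    then have "(\<tau>, \<tau>') \<in> cohomologous ?K 1"
      by simp
    from simplicial_weights.homotopic_sign_line_maps[OF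
        simplicial_weights_partition_fun[OF assms(1,2)] face_closed_sparse_cech this]
    show "homotopy_rel (cover_space \<sigma> n \<epsilon> \<alpha>) RP_inf `` {w1_map \<sigma> n \<epsilon> \<alpha> \<tau>'} =
        homotopy_rel (cover_space \<sigma> n \<epsilon> \<alpha>) RP_inf `` {w1_map \<sigma> n \<epsilon> \<alpha> \<tau>}"
      unfolding w1_map_eq_line_map[OF assms(1)] by (rule homotopy_rel_Image_eq[symmetric])
  qed
  moreover have "\<tau> \<in> cohomologous ?K 1 `` {\<tau>}"
    using equiv_class_self[OF equiv_cohomologous assms(3)] .
  ultimately show ?thesis
    by auto
qed

text \<open>All admissible choices give one and the same class, and the harmonic representative
  shows that the family of choices is nonempty, so the union is that class.\<close>

lemma c1_class_eq:
  assumes "0 < \<epsilon>" "0 \<le> \<alpha>" "\<eta> \<in> cocycles (sparse_cech \<sigma> n \<epsilon> \<alpha>) 2"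
  shows "c1_class \<sigma> n \<epsilon> \<alpha> (cohomologous (sparse_cech \<sigma> n \<epsilon> \<alpha>) 2 `` {\<eta>}) =
    homotopy_rel (cover_space \<sigma> n \<epsilon> \<alpha>) CP_inf `` {bundle_map \<sigma> n \<epsilon> \<alpha> \<eta>}"
proof -
  let ?K = "sparse_cech \<sigma> n \<epsilon> \<alpha>"
  let ?rel = "homotopy_rel (cover_space \<sigma> n \<epsilon> \<alpha>) (CP_inf :: (nat \<Rightarrow> complex) set topology)"
  interpret simplicial_weights n ?K "\<Union>(sparse_cover \<sigma> n \<epsilon> \<alpha>)" "partition_fun \<sigma> n \<epsilon> \<alpha>"
    by (rule simplicial_weights_partition_fun[OF assms(1,2)])
  define C where "C = {?rel `` {c1_map \<sigma> n \<epsilon> \<alpha> \<theta> \<nu>} | \<eta>' \<theta> \<nu>.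
    \<eta>' \<in> cohomologous ?K 2 `` {\<eta>} \<and> harmonic ?K 2 \<theta> \<and> \<nu> \<in> cochains ?K 1
      \<and> \<theta> = (\<lambda>A. real_of_int (\<eta>' A) - coboundary ?K 1 \<nu> A)}"
  have eq: "?rel `` {c1_map \<sigma> n \<epsilon> \<alpha> \<theta> \<nu>} = ?rel `` {bundle_map \<sigma> n \<epsilon> \<alpha> \<eta>}"
    if "\<eta>' \<in> cohomologous ?K 2 `` {\<eta>}" "\<theta> = (\<lambda>A. real_of_int (\<eta>' A) - coboundary ?K 1 \<nu> A)" for \<eta>' \<theta> \<nu>
  proof -
    have rel: "(\<eta>, \<eta>') \<in> cohomologous ?K 2"
      using that(1) by simp
    then have \<eta>': "\<eta>' \<in> cocycles ?K 2"
      by (simp add: cohomologous_def)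
    \<comment> \<open>First \<eta> is replaced by the cohomologous \<open>\<eta>'\<close>, then the
      real cochains are introduced.\<close>
    have "homotopic_with (\<lambda>_. True) (cover_space \<sigma> n \<epsilon> \<alpha>) CP_inf
        (bundle_map \<sigma> n \<epsilon> \<alpha> \<eta>) (c1_map \<sigma> n \<epsilon> \<alpha> \<theta> \<nu>)"
      unfolding c1_map_eq_line_map[OF assms(1)] bundle_map_def
      by (rule homotopic_with_trans[OF homotopic_phase_line_maps[OF face_closed_sparse_cech rel]
            homotopic_phase_line_map[OF face_closed_sparse_cech \<eta>']]) (simp add: that(2))
    then show ?thesis
      by (rule homotopy_rel_Image_eq[symmetric])
  qed
  have "(\<lambda>A. real_of_int (\<eta> A)) \<in> cocycles ?K 2"
    using assms(3) by (auto simp: cocycles_def cochains_def coboundary_of_int)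
  then obtain \<nu> where \<nu>: "\<nu> \<in> cochains ?K 1" "harmonic ?K 2 (\<lambda>A. real_of_int (\<eta> A) - coboundary ?K 1 \<nu> A)"
    using harmonic_representative_exists[OF finite_sparse_cech face_closed_sparse_cech] by blast
  have self: "\<eta> \<in> cohomologous ?K 2 `` {\<eta>}"
    using equiv_class_self[OF equiv_cohomologous assms(3)] .
  have "C = {?rel `` {bundle_map \<sigma> n \<epsilon> \<alpha> \<eta>}}"
  proof
    show "C \<subseteq> {?rel `` {bundle_map \<sigma> n \<epsilon> \<alpha> \<eta>}}"
      unfolding C_def using eq by blast
    have "?rel `` {c1_map \<sigma> n \<epsilon> \<alpha> (\<lambda>A. real_of_int (\<eta> A) - coboundary ?K 1 \<nu> A) \<nu>} \<in> C"
      unfolding C_def using \<nu> self by blast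
    then show "{?rel `` {bundle_map \<sigma> n \<epsilon> \<alpha> \<eta>}} \<subseteq> C"
      using eq[OF self refl] by simp
  qed
  then show ?thesis
    unfolding c1_class_def Let_def C_def[symmetric] by simp
qed

lemma partition_fun_support_simplex:
  assumes "0 < \<epsilon>" "0 \<le> \<alpha>" "b \<in> \<Union>(sparse_cover \<sigma> n \<epsilon> \<alpha>)" "A \<noteq> {}"
    "\<And>r. r \<in> A \<Longrightarrow> r \<le> n \<and> partition_fun \<sigma> n \<epsilon> \<alpha> r b \<noteq> 0"
  shows "A \<in> sparse_cech \<sigma> n \<epsilon> \<alpha>"
proof -
  interpret simplicial_weights n "sparse_cech \<sigma> n \<epsilon> \<alpha>" "\<Union>(sparse_cover \<sigma> n \<epsilon> \<alpha>)" "partition_fun \<sigma> n \<epsilon> \<alpha>"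
    by (rule simplicial_weights_partition_fun[OF assms(1,2)])
  show ?thesis
    using assms(5) weight_nonneg[OF assms(3)]
    by (intro support_face[OF face_closed_sparse_cech assms(3,4)]) (force simp: less_le)
qed

text \<open>The weights are moved with the cocycle kept at scale \<beta>. Restricting the cocycle
  afterwards changes nothing, because the line map at scale \<alpha> only sees simplices of the
  complex at \<alpha>.\<close>

lemma homotopic_restrict_w1_map:
  fixes \<sigma> :: "nat \<Rightarrow> 'a::metric_space"
  assumes greedy: "greedy_permutation n X \<sigma>" and \<epsilon>: "0 < \<epsilon>" and \<alpha>: "0 \<le> \<alpha>" "\<alpha> \<le> \<beta>"
    and \<tau>: "\<tau> \<in> cocycles (sparse_cech \<sigma> n \<epsilon> \<beta>) 1"
  shows "homotopic_with (\<lambda>_. True) (cover_space \<sigma> n \<epsilon> \<alpha>) RP_inf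
    (w1_map \<sigma> n \<epsilon> \<alpha> (\<lambda>A. if A \<in> sparse_cech \<sigma> n \<epsilon> \<alpha> then \<tau> A else 0)) (w1_map \<sigma> n \<epsilon> \<beta> \<tau>)"
proof -
  let ?\<tau> = "\<lambda>A. if A \<in> sparse_cech \<sigma> n \<epsilon> \<alpha> then \<tau> A else 0"
  have "homotopic_with (\<lambda>_. True) (cover_space \<sigma> n \<epsilon> \<alpha>) RP_inf
      (line_map n (partition_fun \<sigma> n \<epsilon> \<alpha>) (\<lambda>r j _. sign_transition \<tau> r j))
      (line_map n (partition_fun \<sigma> n \<epsilon> \<beta>) (\<lambda>r j _. sign_transition \<tau> r j))"
    using simplicial_weights.line_data_sign[OF _ face_closed_sparse_cech \<tau>]
    by (rule homotopic_partition_line_maps[OF greedy \<epsilon> \<alpha>])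
  then show ?thesis
    unfolding w1_map_eq_line_map[OF \<epsilon>]
  proof (rule homotopic_with_eq)
    fix b assume b: "b \<in> topspace (cover_space \<sigma> n \<epsilon> \<alpha>)"
    show "line_map n (partition_fun \<sigma> n \<epsilon> \<alpha>) (\<lambda>r j _. sign_transition ?\<tau> r j) b =
        line_map n (partition_fun \<sigma> n \<epsilon> \<alpha>) (\<lambda>r j _. sign_transition \<tau> r j) b"
    proof (rule line_map_cong[OF refl])
      fix r j assume "r \<le> n" "j \<le> n" "partition_fun \<sigma> n \<epsilon> \<alpha> r b \<noteq> 0" "0 < partition_fun \<sigma> n \<epsilon> \<alpha> j b"
      then have "{r, j} \<in> sparse_cech \<sigma> n \<epsilon> \<alpha>"
        using b by (intro partition_fun_support_simplex[OF \<epsilon> \<alpha>(1), of b]) auto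
      then show "sign_transition ?\<tau> r j = sign_transition \<tau> r j"
        by (simp add: sign_transition_def)
    qed
  qed auto
qed

lemma homotopic_restrict_bundle_map:
  fixes \<sigma> :: "nat \<Rightarrow> 'a::metric_space"
  assumes greedy: "greedy_permutation n X \<sigma>" and \<epsilon>: "0 < \<epsilon>" and \<alpha>: "0 \<le> \<alpha>" "\<alpha> \<le> \<beta>"
    and \<eta>: "\<eta> \<in> cocycles (sparse_cech \<sigma> n \<epsilon> \<beta>) 2"
  shows "homotopic_with (\<lambda>_. True) (cover_space \<sigma> n \<epsilon> \<alpha>) CP_inf
    (bundle_map \<sigma> n \<epsilon> \<alpha> (\<lambda>A. if A \<in> sparse_cech \<sigma> n \<epsilon> \<alpha> then \<eta> A else 0)) (bundle_map \<sigma> n \<epsilon> \<beta> \<eta>)"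
proof -
  let ?\<eta> = "\<lambda>A. if A \<in> sparse_cech \<sigma> n \<epsilon> \<alpha> then \<eta> A else 0"
  have "homotopic_with (\<lambda>_. True) (cover_space \<sigma> n \<epsilon> \<alpha>) CP_inf
      (bundle_map \<sigma> n \<epsilon> \<alpha> \<eta>) (bundle_map \<sigma> n \<epsilon> \<beta> \<eta>)"
    unfolding bundle_map_def
    using simplicial_weights.line_data_phase[OF _ face_closed_sparse_cech \<eta>]
    by (rule homotopic_partition_line_maps[OF greedy \<epsilon> \<alpha>])
  then show ?thesis
  proof (rule homotopic_with_eq)
    interpret simplicial_weights n "sparse_cech \<sigma> n \<epsilon> \<alpha>" "\<Union>(sparse_cover \<sigma> n \<epsilon> \<alpha>)" "partition_fun \<sigma> n \<epsilon> \<alpha>"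
      by (rule simplicial_weights_partition_fun[OF \<epsilon> \<alpha>(1)])
    fix b assume b: "b \<in> topspace (cover_space \<sigma> n \<epsilon> \<alpha>)"
    show "bundle_map \<sigma> n \<epsilon> \<alpha> ?\<eta> b = bundle_map \<sigma> n \<epsilon> \<alpha> \<eta> b"
      unfolding bundle_map_def
    proof (rule line_map_cong[OF refl])
      fix r j assume rj: "r \<le> n" "j \<le> n" "partition_fun \<sigma> n \<epsilon> \<alpha> r b \<noteq> 0" "0 < partition_fun \<sigma> n \<epsilon> \<alpha> j b"
      \<comment> \<open>The third vertex t also has to lie in the support; the weight in front of
        its summand ensures this.\<close>
      have "(\<Sum>t = 0..n. partition_fun \<sigma> n \<epsilon> \<alpha> t b * alternating (\<lambda>A. real_of_int (?\<eta> A)) [r, j, t]) =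
          (\<Sum>t = 0..n. partition_fun \<sigma> n \<epsilon> \<alpha> t b * alternating (\<lambda>A. real_of_int (\<eta> A)) [r, j, t])"
      proof (rule weighted_sum_cong)
        fix t assume "t \<le> n" "0 < partition_fun \<sigma> n \<epsilon> \<alpha> t b"
        then have "{r, j, t} \<in> sparse_cech \<sigma> n \<epsilon> \<alpha>"
          using b rj by (intro partition_fun_support_simplex[OF \<epsilon> \<alpha>(1), of b]) auto
        then show "alternating (\<lambda>A. real_of_int (?\<eta> A)) [r, j, t] = alternating (\<lambda>A. real_of_int (\<eta> A)) [r, j, t]"
          by (simp add: alternating_triple)
      qed (use b in simp)
      then show "phase_transition n ?\<eta> (\<lambda>t. partition_fun \<sigma> n \<epsilon> \<alpha> t b) r j =
          phase_transition n \<eta> (\<lambda>t. partition_fun \<sigma> n \<epsilon> \<alpha> t b) r j"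
        by (simp only: phase_transition_def)
    qed
  qed auto
qed

theorem proposition7p6:
  fixes X :: "'a::metric_space set" and \<sigma> :: "nat \<Rightarrow> 'a" and n :: nat and \<epsilon> \<alpha> \<beta> :: real
  assumes "finite X" and "card X = n + 1"
    and "greedy_permutation n X \<sigma>"
    and "0 < \<epsilon>" and "\<epsilon> < 1"
    and "0 \<le> \<alpha>" and "\<alpha> \<le> \<beta>"
  shows "sparse_cech \<sigma> n \<epsilon> \<alpha> \<subseteq> sparse_cech \<sigma> n \<epsilon> \<beta> \<and>
         \<Union>(sparse_cover \<sigma> n \<epsilon> \<alpha>) \<subseteq> \<Union>(sparse_cover \<sigma> n \<epsilon> \<beta>) \<and>
         commutative_square
           (cohomology (sparse_cech \<sigma> n \<epsilon> \<alpha>) 1 :: (nat set \<Rightarrow> bit) set set)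
           (homotopy_classes (cover_space \<sigma> n \<epsilon> \<alpha>) RP_inf)
           (cohomology (sparse_cech \<sigma> n \<epsilon> \<beta>) 1 :: (nat set \<Rightarrow> bit) set set)
           (homotopy_classes (cover_space \<sigma> n \<epsilon> \<beta>) RP_inf)
           (w1_class \<sigma> n \<epsilon> \<alpha>)
           (w1_class \<sigma> n \<epsilon> \<beta>)
           (restrict_cohomology (sparse_cech \<sigma> n \<epsilon> \<alpha>) 1)
           (restrict_homotopy_class (cover_space \<sigma> n \<epsilon> \<alpha>) RP_inf) \<and>
         commutative_square
           (cohomology (sparse_cech \<sigma> n \<epsilon> \<alpha>) 2 :: (nat set \<Rightarrow> int) set set)
           (homotopy_classes (cover_space \<sigma> n \<epsilon> \<alpha>) CP_inf)
           (cohomology (sparse_cech \<sigma> n \<epsilon> \<beta>) 2 :: (nat set \<Rightarrow> int) set set)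
           (homotopy_classes (cover_space \<sigma> n \<epsilon> \<beta>) CP_inf)
           (c1_class \<sigma> n \<epsilon> \<alpha>)
           (c1_class \<sigma> n \<epsilon> \<beta>)
           (restrict_cohomology (sparse_cech \<sigma> n \<epsilon> \<alpha>) 2)
           (restrict_homotopy_class (cover_space \<sigma> n \<epsilon> \<alpha>) CP_inf)"
proof (intro conjI)
  note greedy = assms(3) and \<epsilon> = assms(4) and \<alpha> = assms(6,7)
  have \<beta>: "0 \<le> \<beta>"
    using \<alpha> by simp
  show K: "sparse_cech \<sigma> n \<epsilon> \<alpha> \<subseteq> sparse_cech \<sigma> n \<epsilon> \<beta>"
    by (rule sparse_cech_mono[OF \<alpha>(2)])
  show S: "\<Union>(sparse_cover \<sigma> n \<epsilon> \<alpha>) \<subseteq> \<Union>(sparse_cover \<sigma> n \<epsilon> \<beta>)"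
    by (rule Union_sparse_cover_mono[OF greedy \<epsilon> \<alpha>])
  show "commutative_square
           (cohomology (sparse_cech \<sigma> n \<epsilon> \<alpha>) 1 :: (nat set \<Rightarrow> bit) set set)
           (homotopy_classes (cover_space \<sigma> n \<epsilon> \<alpha>) RP_inf)
           (cohomology (sparse_cech \<sigma> n \<epsilon> \<beta>) 1 :: (nat set \<Rightarrow> bit) set set)
           (homotopy_classes (cover_space \<sigma> n \<epsilon> \<beta>) RP_inf)
           (w1_class \<sigma> n \<epsilon> \<alpha>)
           (w1_class \<sigma> n \<epsilon> \<beta>)
           (restrict_cohomology (sparse_cech \<sigma> n \<epsilon> \<alpha>) 1)
           (restrict_homotopy_class (cover_space \<sigma> n \<epsilon> \<alpha>) RP_inf)"
    by (rule commutative_squareI[where m = "w1_map \<sigma> n \<epsilon> \<alpha>" and m' = "w1_map \<sigma> n \<epsilon> \<beta>"])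
      (assumption | rule K face_closed_sparse_cech S w1_class_eq[OF \<epsilon> \<alpha>(1)] w1_class_eq[OF \<epsilon> \<beta>]
        continuous_w1_map[OF \<epsilon> \<alpha>(1)] continuous_w1_map[OF \<epsilon> \<beta>]
        homotopic_restrict_w1_map[OF greedy \<epsilon> \<alpha>])+
  \<comment> \<open>\<open>bundle_map\<close> represents the class here, since it is a function of
    \<eta> alone, whereas \<open>c1_map\<close> needs a choice of \<theta> and \<nu>.\<close>
  show "commutative_square
           (cohomology (sparse_cech \<sigma> n \<epsilon> \<alpha>) 2 :: (nat set \<Rightarrow> int) set set)
           (homotopy_classes (cover_space \<sigma> n \<epsilon> \<alpha>) CP_inf)
           (cohomology (sparse_cech \<sigma> n \<epsilon> \<beta>) 2 :: (nat set \<Rightarrow> int) set set)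
           (homotopy_classes (cover_space \<sigma> n \<epsilon> \<beta>) CP_inf)
           (c1_class \<sigma> n \<epsilon> \<alpha>)
           (c1_class \<sigma> n \<epsilon> \<beta>)
           (restrict_cohomology (sparse_cech \<sigma> n \<epsilon> \<alpha>) 2)
           (restrict_homotopy_class (cover_space \<sigma> n \<epsilon> \<alpha>) CP_inf)"
    by (rule commutative_squareI[where m = "bundle_map \<sigma> n \<epsilon> \<alpha>" and m' = "bundle_map \<sigma> n \<epsilon> \<beta>"])
      (assumption | rule K face_closed_sparse_cech S c1_class_eq[OF \<epsilon> \<alpha>(1)] c1_class_eq[OF \<epsilon> \<beta>]
        continuous_bundle_map[OF \<epsilon> \<alpha>(1)] continuous_bundle_map[OF \<epsilon> \<beta>]
        homotopic_restrict_bundle_map[OF greedy \<epsilon> \<alpha>])+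
qed

end
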